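(* Let $\{\pi_k\}_{k\ge 0}$ be the policy sequence generated by PMD with mirror map $h(p)=\sum_{a}\psi(p(a))$ and a constant step size $\eta>0$. If $\psi'(0^+)>-\infty$ and $\psi'(1^-)<+\infty$, then there exists a termination time $T_{\mathrm{ter}}$ for PMD, i.e. $$\forall\, t\ge T_{\mathrm{ter}}:\quad \pi_t=\pi_{T_{\mathrm{ter}}}\in\Pi^*.$$ Furthermore, $$T_{\mathrm{ter}}\le T(\Delta/4)+\left\lceil\frac{4(\psi'(1^-)-\psi'(0^+))}{\eta\Delta}\right\rceil+1\le\left\lceil\frac{4}{\Delta}\left(\frac{C_\psi}{\eta(1-\gamma)}+\frac{1}{(1-\gamma)^2}\right)\right\rceil+\left\lceil\frac{4(\psi'(1^-)-\psi'(0^+))}{\eta\Delta}\right\rceil,$$ where $C_\psi:=2\sup_{p\in\Delta(\mathcal A)}\left|\sum_{a\in\mathcal A}\psi(p(a))\right|+2\sup_{x\in[0,1]}|\psi'(x)|<\infty$.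
   Context: MDP: $(\mathcal S,\mathcal A,P,r,\gamma)$ is a finite discounted Markov decision process: finite state space $\mathcal S$, finite action space $\mathcal A$, transition model $P(\cdot|s,a)\in\Delta(\mathcal S)$, reward $r:\mathcal S\times\mathcal A\to[0,1]$, discount $\gamma\in[0,1)$. $\Delta(\mathcal X)$ is the probability simplex over a finite set $\mathcal X$. A policy $\pi$ assigns to each $s$ a distribution $\pi(\cdot|s)\in\Delta(\mathcal A)$; $\Pi$ is the set of all policies. $V^\pi(s)$ is the expected value of $\sum_{t\ge0}\gamma^t r(s_t,a_t)$ given $s_0=s$, $a_t\sim\pi(\cdot|s_t)$, $s_{t+1}\sim P(\cdot|s_t,a_t)$, and $Q^\pi(s,a)$ is the same conditioned on $(s_0,a_0)=(s,a)$. $V^*(s)=\max_{\pi\in\Pi}V^\pi(s)$, $Q^*(s,a)=\max_{\pi\in\Pi}Q^\pi(s,a)$; $\Pi^*$ is the set of optimal policies ($V^\pi=V^*$). $\mathcal A^*_s=\{a: Q^*(s,a)=V^*(s)\}$, $\tilde{\mathcal S}=\{s:\mathcal A_s^*\ne\mathcal A\}$, assumed nonempty throughout. For $s\in\tilde{\mathcal S}$, $\Delta_s=V^*(s)-\max_{a'\notin\mathcal A_s^*}Q^*(s,a')$, and $\Delta=\min_{s\in\tilde{\mathcal S}}\Delta_s>0$ (a number; not to be confused with the simplex $\Delta(\cdot)$). Mirror map: $\psi:\mathbb R\to(-\infty,+\infty]$ satisfies: (a) $\mathrm{dom}\,\psi\supseteq[0,1]$; (b) $\psi$ is proper, closed and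 convex; (c) $\psi$ is differentiable on $\mathrm{int}\,\mathrm{dom}\,\psi$ and $|\psi'(x_n)|\to\infty$ for every sequence $\{x_n\}\subseteq\mathrm{int}\,\mathrm{dom}\,\psi$ converging to a boundary point of $\mathrm{dom}\,\psi$; (d) $\psi$ is strictly convex on $\mathrm{int}\,\mathrm{dom}\,\psi$. $\psi'(0^+)$ and $\psi'(1^-)$ are the one-sided limits of $\psi'$ at $0$ from the right and at $1$ from the left. $h(p)=\sum_{a\in\mathcal A}\psi(p(a))$ and $D_h(p\|q)=h(p)-h(q)-\langle\nabla h(q),p-q\rangle$. PMD: given $\eta>0$ and an initial policy $\pi_0$ with $\pi_0(a|s)\in\mathrm{int}\,\mathrm{dom}\,\psi$ for all $(s,a)$ (assumed throughout), for each $s$, $\pi_{k+1}(\cdot|s)=\arg\max_{p\in\Delta(\mathcal A)}\{\eta\langle p,Q^{\pi_k}(s,\cdot)\rangle-D_h(p\|\pi_k(\cdot|s))\}$; all iterates satisfy $\pi_k(a|s)\in\mathrm{int}\,\mathrm{dom}\,\psi$. For $\sigma>0$, $T(\sigma):=\min\{k:\ \|V^*-V^{\pi_k}\|_\infty\le\sigma\}$, which is finite. *)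

theory Defs
  imports "HOL-Probability.Probability"
begin

section \<open>Finite discounted Markov decision processes\<close>

text \<open>
  States and actions are the elements of finite types. The simplex over a finite type
  is the type of probability mass functions on it, so a transition model has type
  \<^typ>\<open>'s \<Rightarrow> 'a \<Rightarrow> 's pmf\<close> and a policy has type \<^typ>\<open>'s \<Rightarrow> 'a pmf\<close>.
\<close>

type_synonym ('s, 'a) policy = "'s \<Rightarrow> 'a pmf"

definition next_pair ::
  "('s \<Rightarrow> 'a \<Rightarrow> 's pmf) \<Rightarrow> ('s, 'a) policy \<Rightarrow> 's \<times> 'a \<Rightarrow> ('s \<times> 'a) pmf" where
  "next_pair P \<pi> sa = bind_pmf (P (fst sa) (snd sa)) (\<lambda>s'. map_pmf (Pair s') (\<pi> s'))"

definition traj_kernel ::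
  "('s \<Rightarrow> 'a \<Rightarrow> 's pmf) \<Rightarrow> ('s, 'a) policy \<Rightarrow> ('s \<times> 'a) pmf
    \<Rightarrow> nat \<Rightarrow> (nat \<Rightarrow> 's \<times> 'a) \<Rightarrow> ('s \<times> 'a) measure" where
  "traj_kernel P \<pi> \<mu> n \<omega> = measure_pmf (if n = 0 then \<mu> else next_pair P \<pi> (\<omega> (n - 1)))"

text \<open>
  The law of the trajectory \<open>(s\<^sub>0, a\<^sub>0), (s\<^sub>1, a\<^sub>1), \<dots>\<close> when \<open>(s\<^sub>0, a\<^sub>0)\<close> has law \<open>\<mu>\<close>,
  obtained from the Ionescu-Tulcea theorem (applicable by the lemma that follows).
\<close>

definition trajectory ::
  "('s \<Rightarrow> 'a \<Rightarrow> 's pmf) \<Rightarrow> ('s, 'a) policy \<Rightarrow> ('s \<times> 'a) pmf \<Rightarrow> (nat \<Rightarrow> 's \<times> 'a) measure" where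
  "trajectory P \<pi> \<mu> =
    projective_family.lim UNIV
      (Ionescu_Tulcea.CI (traj_kernel P \<pi> \<mu>) (\<lambda>_. count_space UNIV))
      (\<lambda>_. count_space UNIV)"

lemma Ionescu_Tulcea_traj_kernel:
  fixes P :: "'s::finite \<Rightarrow> 'a::finite \<Rightarrow> 's pmf"
  shows "Ionescu_Tulcea (traj_kernel P \<pi> \<mu>) (\<lambda>_. count_space UNIV)"
proof (rule Ionescu_Tulcea.intro)
  fix n :: nat
  show "traj_kernel P \<pi> \<mu> n
    \<in> measurable (PiM {0..<n} (\<lambda>_. count_space UNIV)) (subprob_algebra (count_space UNIV))"
  proof (cases "n = 0")
    case True
    then show ?thesis
      by (auto simp: traj_kernel_def[abs_def] space_subprob_algebra
               intro!: measurable_const measure_pmf.subprob_space_axioms)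
  next
    case False
    have K: "(\<lambda>x. measure_pmf (next_pair P \<pi> x))
        \<in> measurable (count_space UNIV) (subprob_algebra (count_space UNIV))"
      by (auto simp: space_subprob_algebra intro!: measure_pmf.subprob_space_axioms)
    have "(\<lambda>\<omega>. \<omega> (n - 1))
        \<in> measurable (PiM {0..<n} (\<lambda>_. count_space UNIV :: ('s \<times> 'a) measure)) (count_space UNIV)"
      using False by (intro measurable_component_singleton) auto
    from measurable_compose[OF this K] False show ?thesis
      by (simp add: traj_kernel_def[abs_def])
  qed
next
  fix n :: nat and \<omega> :: "nat \<Rightarrow> 's \<times> 'a"
  show "prob_space (traj_kernel P \<pi> \<mu> n \<omega>)"
    by (simp add: traj_kernel_def measure_pmf.prob_space_axioms)
qed

definition discounted_return ::
  "('s \<Rightarrow> 'a \<Rightarrow> real) \<Rightarrow> real \<Rightarrow> (nat \<Rightarrow> 's \<times> 'a) \<Rightarrow> real" where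
  "discounted_return r \<gamma> \<omega> = (\<Sum>t. \<gamma> ^ t * r (fst (\<omega> t)) (snd (\<omega> t)))"

definition V_fun ::
  "('s \<Rightarrow> 'a \<Rightarrow> 's pmf) \<Rightarrow> ('s \<Rightarrow> 'a \<Rightarrow> real) \<Rightarrow> real \<Rightarrow> ('s, 'a) policy \<Rightarrow> 's \<Rightarrow> real" where
  "V_fun P r \<gamma> \<pi> s =
    (\<integral>\<omega>. discounted_return r \<gamma> \<omega> \<partial>trajectory P \<pi> (map_pmf (Pair s) (\<pi> s)))"

definition Q_fun ::
  "('s \<Rightarrow> 'a \<Rightarrow> 's pmf) \<Rightarrow> ('s \<Rightarrow> 'a \<Rightarrow> real) \<Rightarrow> real \<Rightarrow> ('s, 'a) policy \<Rightarrow> 's \<Rightarrow> 'a \<Rightarrow> real" where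
  "Q_fun P r \<gamma> \<pi> s a =
    (\<integral>\<omega>. discounted_return r \<gamma> \<omega> \<partial>trajectory P \<pi> (return_pmf (s, a)))"

text \<open>The policy space is infinite, so the maxima over all policies are written as suprema.\<close>

definition V_opt ::
  "('s \<Rightarrow> 'a \<Rightarrow> 's pmf) \<Rightarrow> ('s \<Rightarrow> 'a \<Rightarrow> real) \<Rightarrow> real \<Rightarrow> 's \<Rightarrow> real" where
  "V_opt P r \<gamma> s = (SUP \<pi>. V_fun P r \<gamma> \<pi> s)"

definition Q_opt ::
  "('s \<Rightarrow> 'a \<Rightarrow> 's pmf) \<Rightarrow> ('s \<Rightarrow> 'a \<Rightarrow> real) \<Rightarrow> real \<Rightarrow> 's \<Rightarrow> 'a \<Rightarrow> real" where
  "Q_opt P r \<gamma> s a = (SUP \<pi>. Q_fun P r \<gamma> \<pi> s a)"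

definition optimal_policies ::
  "('s \<Rightarrow> 'a \<Rightarrow> 's pmf) \<Rightarrow> ('s \<Rightarrow> 'a \<Rightarrow> real) \<Rightarrow> real \<Rightarrow> ('s, 'a) policy set" where
  "optimal_policies P r \<gamma> = {\<pi>. V_fun P r \<gamma> \<pi> = V_opt P r \<gamma>}"

definition optimal_actions ::
  "('s \<Rightarrow> 'a \<Rightarrow> 's pmf) \<Rightarrow> ('s \<Rightarrow> 'a \<Rightarrow> real) \<Rightarrow> real \<Rightarrow> 's \<Rightarrow> 'a set" where
  "optimal_actions P r \<gamma> s = {a. Q_opt P r \<gamma> s a = V_opt P r \<gamma> s}"

definition nontrivial_states ::
  "('s \<Rightarrow> 'a \<Rightarrow> 's pmf) \<Rightarrow> ('s \<Rightarrow> 'a \<Rightarrow> real) \<Rightarrow> real \<Rightarrow> 's set" where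
  "nontrivial_states P r \<gamma> = {s. optimal_actions P r \<gamma> s \<noteq> UNIV}"

definition state_gap ::
  "('s \<Rightarrow> 'a::finite \<Rightarrow> 's pmf) \<Rightarrow> ('s \<Rightarrow> 'a \<Rightarrow> real) \<Rightarrow> real \<Rightarrow> 's \<Rightarrow> real" where
  "state_gap P r \<gamma> s = V_opt P r \<gamma> s - (MAX a'\<in>- optimal_actions P r \<gamma> s. Q_opt P r \<gamma> s a')"

definition gap ::
  "('s::finite \<Rightarrow> 'a::finite \<Rightarrow> 's pmf) \<Rightarrow> ('s \<Rightarrow> 'a \<Rightarrow> real) \<Rightarrow> real \<Rightarrow> real" where
  "gap P r \<gamma> = (MIN s\<in>nontrivial_states P r \<gamma>. state_gap P r \<gamma> s)"


section \<open>Separable mirror maps and Bregman divergences\<close>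

definition edom :: "('v \<Rightarrow> ereal) \<Rightarrow> 'v set" where
  "edom f = {x. f x < \<infinity>}"

definition eepigraph :: "('v \<Rightarrow> ereal) \<Rightarrow> ('v \<times> real) set" where
  "eepigraph f = {(x, y). f x \<le> ereal y}"

text \<open>The derivative of an extended-valued function; meaningful on the interior of its domain.\<close>

definition ederiv :: "(real \<Rightarrow> ereal) \<Rightarrow> real \<Rightarrow> real" where
  "ederiv \<psi> x = deriv (\<lambda>y. real_of_ereal (\<psi> y)) x"

definition mirror_map :: "(real \<Rightarrow> ereal) \<Rightarrow> bool" where
  "mirror_map \<psi> \<longleftrightarrow>
    {0..1} \<subseteq> edom \<psi> \<and>
    (\<forall>x. \<psi> x \<noteq> -\<infinity>) \<and> edom \<psi> \<noteq> {} \<and> closed (eepigraph \<psi>) \<and> convex (eepigraph \<psi>) \<and>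
    (\<forall>x\<in>interior (edom \<psi>). (\<lambda>y. real_of_ereal (\<psi> y)) differentiable (at x)) \<and>
    (\<forall>X c. (\<forall>n. X n \<in> interior (edom \<psi>)) \<and> c \<in> frontier (edom \<psi>) \<and> X \<longlonglongrightarrow> c
        \<longrightarrow> filterlim (\<lambda>n. \<bar>ederiv \<psi> (X n)\<bar>) at_top sequentially) \<and>
    (\<forall>x\<in>interior (edom \<psi>). \<forall>y\<in>interior (edom \<psi>). \<forall>u\<in>{0<..<1}. x \<noteq> y
        \<longrightarrow> \<psi> ((1 - u) * x + u * y) < ereal (1 - u) * \<psi> x + ereal u * \<psi> y)"

text \<open>The one-sided limits \<open>\<psi>'(0\<^sup>+)\<close> and \<open>\<psi>'(1\<^sup>-)\<close>, which may be infinite.\<close>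

definition ederiv_right0 :: "(real \<Rightarrow> ereal) \<Rightarrow> ereal" where
  "ederiv_right0 \<psi> = Lim (at_right 0) (\<lambda>x. ereal (ederiv \<psi> x))"

definition ederiv_left1 :: "(real \<Rightarrow> ereal) \<Rightarrow> ereal" where
  "ederiv_left1 \<psi> = Lim (at_left 1) (\<lambda>x. ereal (ederiv \<psi> x))"

definition separable :: "(real \<Rightarrow> ereal) \<Rightarrow> ('a::finite \<Rightarrow> real) \<Rightarrow> ereal" where
  "separable \<psi> p = (\<Sum>a\<in>UNIV. \<psi> (p a))"

text \<open>The vector of partial derivatives.\<close>

definition gradient :: "(('a \<Rightarrow> real) \<Rightarrow> ereal) \<Rightarrow> ('a \<Rightarrow> real) \<Rightarrow> 'a \<Rightarrow> real" where
  "gradient h q a = ederiv (\<lambda>x. h (q(a := x))) (q a)"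

definition bregman ::
  "(('a::finite \<Rightarrow> real) \<Rightarrow> ereal) \<Rightarrow> ('a \<Rightarrow> real) \<Rightarrow> ('a \<Rightarrow> real) \<Rightarrow> ereal" where
  "bregman h p q = h p - h q - ereal (\<Sum>a\<in>UNIV. gradient h q a * (p a - q a))"

text \<open>The constant \<open>C\<^sub>\<psi>\<close>; it depends on the action type, which is passed as a type argument.\<close>

definition C_const :: "'a::finite itself \<Rightarrow> (real \<Rightarrow> ereal) \<Rightarrow> ereal" where
  "C_const _ \<psi> =
    2 * (SUP p :: 'a pmf. \<bar>separable \<psi> (pmf p)\<bar>) + 2 * (SUP x\<in>{0..1}. ereal \<bar>ederiv \<psi> x\<bar>)"


section \<open>Policy mirror descent\<close>

definition pmd ::
  "('s \<Rightarrow> 'a::finite \<Rightarrow> 's pmf) \<Rightarrow> ('s \<Rightarrow> 'a \<Rightarrow> real) \<Rightarrow> real \<Rightarrow> (real \<Rightarrow> ereal) \<Rightarrow> real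
    \<Rightarrow> (nat \<Rightarrow> ('s, 'a) policy) \<Rightarrow> bool" where
  "pmd P r \<gamma> \<psi> \<eta> \<pi> \<longleftrightarrow>
    (\<forall>s a. pmf (\<pi> 0 s) a \<in> interior (edom \<psi>)) \<and>
    (\<forall>k s. is_arg_max
      (\<lambda>p :: 'a pmf. ereal (\<eta> * (\<Sum>a\<in>UNIV. pmf p a * Q_fun P r \<gamma> (\<pi> k) s a))
                      - bregman (separable \<psi>) (pmf p) (pmf (\<pi> k s)))
      (\<lambda>_. True) (\<pi> (Suc k) s))"

text \<open>The first index at which the sup-norm suboptimality is at most \<open>\<sigma>\<close>.\<close>

definition hitting_time ::
  "('s::finite \<Rightarrow> 'a \<Rightarrow> 's pmf) \<Rightarrow> ('s \<Rightarrow> 'a \<Rightarrow> real) \<Rightarrow> real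
    \<Rightarrow> (nat \<Rightarrow> ('s, 'a) policy) \<Rightarrow> real \<Rightarrow> nat" where
  "hitting_time P r \<gamma> \<pi> \<sigma> =
    (LEAST k. (MAX s. \<bar>V_opt P r \<gamma> s - V_fun P r \<gamma> (\<pi> k) s\<bar>) \<le> \<sigma>)"

end

theory Submission
  imports Defs
begin

text \<open>
  The argument has two halves: a sublinear bound on the value error, and a finite-time argument
  that turns a small value error into exact optimality.

  Both halves use one fact about a mirror descent step from \<open>q\<close> to \<open>p\<close>, namely its first-order
  optimality condition
  \<open>(\<Sum>a. (\<eta> Q a - \<psi>'(p a) + \<psi>'(q a)) (p' a - p a)) \<le> 0\<close> for every distribution \<open>p'\<close>
  (\<open>mirror_step_first_order\<close>). It is available because finite one-sided slopes force \<open>0\<close> and \<open>1\<close>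
  into the interior of the domain of \<open>\<psi>\<close>: at a boundary point of the domain the slope blows up.
  So \<open>\<psi>\<close> is differentiable and \<open>\<psi>'\<close> is strictly increasing and continuous on all of \<open>[0,1]\<close>.

  For the rate, \<open>p' = \<pi>\<^sub>k\<close> shows that the values never decrease, and \<open>p' = \<pi>\<^sup>*\<close>
  bounds the advantage of the optimal policy by a telescoping difference of Bregman divergences. Let
  \<open>U\<close> be the sum of the errors \<open>V\<^sup>* - V\<^sup>\<pi>\<close> over the first \<open>k + 1\<close> iterates. The bounds add up to
  \<open>U \<le> b + \<gamma> P\<^sup>* U\<close> with \<open>b = 1/(1 - \<gamma>) + C\<^sub>\<psi>/\<eta>\<close>; evaluating at the maximum of \<open>U\<close> gives
  \<open>U \<le> b/(1 - \<gamma>)\<close>, and by monotonicity the last error is at most \<open>U/(k + 1)\<close>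
  (\<open>sublinear_convergence\<close>). This sidesteps visitation measures: only the Bellman equations are used.

  For termination, once all values are within \<open>\<Delta>/4\<close> of optimal, the current action values
  separate optimal actions from the others by at least \<open>3\<Delta>/4\<close>. Testing optimality of the step with
  a transfer of mass from a suboptimal action \<open>a\<close> that still has mass to an optimal action \<open>b\<close> shows
  that \<open>\<psi>'(\<pi>(a)) - \<psi>'(\<pi>(b))\<close> decreases by at least \<open>3\<eta>\<Delta>/4\<close> (\<open>exchange_suboptimal\<close>).
  This difference lies between \<open>-M\<close> and \<open>M\<close> for \<open>M = \<psi>'(1) - \<psi>'(0)\<close>, so the decrease cannot go on
  for more than \<open>8M/(3\<eta>\<Delta>)\<close> steps. An individual suboptimal action may lose its mass and regain it
  from another one, so the potential has to be built on the largest suboptimal mass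
  (\<open>suboptimal_mass_vanishes\<close>); once that mass is zero it stays zero. A policy supported on
  optimal actions is optimal, and an optimal policy is a fixed point of the iteration since \<open>\<psi>'\<close> is
  injective (\<open>optimal_policy_is_fixed\<close>).
\<close>

section \<open>The law of a trajectory\<close>

primrec pair_law ::
  "('s \<Rightarrow> 'a \<Rightarrow> 's pmf) \<Rightarrow> ('s, 'a) policy \<Rightarrow> ('s \<times> 'a) pmf \<Rightarrow> nat \<Rightarrow> ('s \<times> 'a) pmf" where
  "pair_law P \<pi> \<mu> 0 = \<mu>"
| "pair_law P \<pi> \<mu> (Suc n) = bind_pmf (pair_law P \<pi> \<mu> n) (next_pair P \<pi>)"

lemma expectation_bind_finite:
  fixes p :: "'b::finite pmf" and f :: "'b \<Rightarrow> 'c::finite pmf" and h :: "'c \<Rightarrow> real"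
  shows "measure_pmf.expectation (bind_pmf p f) h =
    measure_pmf.expectation p (\<lambda>x. measure_pmf.expectation (f x) h)"
  by (subst pmf_expectation_bind[of UNIV]) (auto simp: integral_measure_pmf[of UNIV])

text \<open>
  The Ionescu-Tulcea limit is known through its finite-dimensional marginals; the marginal on the
  first \<open>n + 1\<close> coordinates is the iterated kernel \<open>IT.C 0 (Suc n)\<close>. Its last coordinate arises from
  the previous one by a transition of the chain on state-action pairs.
\<close>

lemma nn_integral_trajectory:
  fixes P :: "'s::finite \<Rightarrow> 'a::finite \<Rightarrow> 's pmf" and f :: "'s \<times> 'a \<Rightarrow> ennreal"
  shows "(\<integral>\<^sup>+\<omega>. f (\<omega> n) \<partial>trajectory P \<pi> \<mu>) = (\<integral>\<^sup>+x. f x \<partial>pair_law P \<pi> \<mu> n)"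
proof -
  interpret IT: Ionescu_Tulcea "traj_kernel P \<pi> \<mu>" "\<lambda>_. count_space UNIV"
    by (rule Ionescu_Tulcea_traj_kernel)
  let ?M = "\<lambda>_::nat. count_space UNIV :: ('s \<times> 'a) measure"
  let ?C = "\<lambda>n. IT.C 0 n (\<lambda>_. undefined)"
  have ini: "(\<lambda>_. undefined) \<in> space (PiM {0..<0} ?M)"
    by (simp add: space_PiM)
  have up: "IT.up_to {0..<Suc n} = Suc n" for n
  proof (rule antisym)
    show "IT.up_to {0..<Suc n} \<le> Suc n" by (subst IT.up_to_iff) auto
    show "Suc n \<le> IT.up_to {0..<Suc n}" using IT.up_to_less[of "{0..<Suc n}" n] by simp
  qed
  have CI: "IT.CI {0..<Suc n} = ?C (Suc n)" for n
    unfolding IT.CI_def up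
    using IT.distr_C[OF order_refl ini, of "Suc n"] by (simp only: add_0)
  have comp[measurable]: "(\<lambda>\<omega>. f (\<omega> i)) \<in> borel_measurable (PiM I ?M)"
    if "i \<in> I" for f :: "'s \<times> 'a \<Rightarrow> ennreal" and i I
    by (rule measurable_compose[OF measurable_component_singleton[OF that]]) simp
  have rec: "(\<integral>\<^sup>+\<omega>. f (\<omega> n) \<partial>?C (Suc n)) = (\<integral>\<^sup>+\<omega>. (\<integral>\<^sup>+x. f x \<partial>traj_kernel P \<pi> \<mu> n \<omega>) \<partial>?C n)" for f n
  proof -
    have eq: "measurable (?C n) (subprob_algebra (PiM {0..<Suc n} ?M))
      = measurable (PiM {0..<n} ?M) (subprob_algebra (PiM {0..<Suc n} ?M))"
      using IT.sets_C[OF ini, of n] by (intro measurable_cong_sets) auto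
    have meas: "IT.eP n \<in> measurable (?C n) (subprob_algebra (PiM {0..<Suc n} ?M))"
      unfolding eq by (rule IT.measurable_eP)
    have "(\<integral>\<^sup>+\<omega>. f (\<omega> n) \<partial>?C (Suc n)) = (\<integral>\<^sup>+\<omega>. (\<integral>\<^sup>+\<omega>'. f (\<omega>' n) \<partial>IT.eP n \<omega>) \<partial>?C n)"
      unfolding IT.C.simps add_0
      by (rule nn_integral_bind[OF _ meas]) (rule comp, simp)
    also have "\<dots> = (\<integral>\<^sup>+\<omega>. (\<integral>\<^sup>+x. f x \<partial>traj_kernel P \<pi> \<mu> n \<omega>) \<partial>?C n)"
    proof (rule nn_integral_cong)
      fix \<omega> assume "\<omega> \<in> space (?C n)"
      then have "\<omega> \<in> space (PiM {0..<n} ?M)"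
        using IT.space_C[OF ini, of n] by (simp only: add_0)
      then show "(\<integral>\<^sup>+\<omega>'. f (\<omega>' n) \<partial>IT.eP n \<omega>) = (\<integral>\<^sup>+x. f x \<partial>traj_kernel P \<pi> \<mu> n \<omega>)"
        by (subst IT.nn_integral_eP) (auto intro!: comp)
    qed
    finally show ?thesis .
  qed
  have law: "(\<integral>\<^sup>+\<omega>. f (\<omega> n) \<partial>?C (Suc n)) = (\<integral>\<^sup>+x. f x \<partial>pair_law P \<pi> \<mu> n)" for f n
  proof (induction n arbitrary: f)
    case 0
    interpret C0: prob_space "?C 0" by (rule IT.prob_space_C[OF ini])
    show ?case
      unfolding rec by (simp add: traj_kernel_def C0.emeasure_space_1 del: IT.C.simps)
  next
    case (Suc n)
    have kernel_Suc: "traj_kernel P \<pi> \<mu> (Suc n) \<omega> = measure_pmf (next_pair P \<pi> (\<omega> n))" for \<omega>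
      by (simp add: traj_kernel_def)
    show ?case
      unfolding rec[where n = "Suc n"]
      using Suc[where f = "\<lambda>y. \<integral>\<^sup>+x. f x \<partial>next_pair P \<pi> y"]
      by (simp add: kernel_Suc del: IT.C.simps)
  qed
  have "(\<integral>\<^sup>+\<omega>. f (\<omega> n) \<partial>trajectory P \<pi> \<mu>)
      = (\<integral>\<^sup>+\<omega>. f (restrict \<omega> {0..<Suc n} n) \<partial>IT.PF.lim)"
    by (simp add: trajectory_def)
  also have "\<dots> = (\<integral>\<^sup>+\<omega>. f (\<omega> n) \<partial>distr IT.PF.lim (PiM {0..<Suc n} ?M) (\<lambda>\<omega>. restrict \<omega> {0..<Suc n}))"
    by (subst nn_integral_distr)
       (auto intro!: comp measurable_restrict_subset simp: measurable_cong_sets[OF IT.PF.sets_lim refl]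
         simp del: restrict_apply)
  also have "\<dots> = (\<integral>\<^sup>+x. f x \<partial>pair_law P \<pi> \<mu> n)"
    by (simp only: IT.distr_lim[OF finite_atLeastLessThan] CI law)
  finally show ?thesis .
qed

lemma measurable_trajectory_coordinate:
  fixes P :: "'s::finite \<Rightarrow> 'a::finite \<Rightarrow> 's pmf" and f :: "'s \<times> 'a \<Rightarrow> 'b::topological_space"
  shows "(\<lambda>\<omega>. f (\<omega> n)) \<in> borel_measurable (trajectory P \<pi> \<mu>)"
proof -
  interpret IT: Ionescu_Tulcea "traj_kernel P \<pi> \<mu>" "\<lambda>_. count_space UNIV"
    by (rule Ionescu_Tulcea_traj_kernel)
  show ?thesis
    unfolding trajectory_def measurable_cong_sets[OF IT.PF.sets_lim refl]
    by (rule measurable_compose[OF measurable_component_singleton]) simp_all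
qed

lemma
  fixes P :: "'s::finite \<Rightarrow> 'a::finite \<Rightarrow> 's pmf" and f :: "'s \<times> 'a \<Rightarrow> real"
  assumes f: "\<And>x. 0 \<le> f x"
  shows integrable_trajectory: "integrable (trajectory P \<pi> \<mu>) (\<lambda>\<omega>. f (\<omega> n))" (is ?A)
    and integral_trajectory:
      "(\<integral>\<omega>. f (\<omega> n) \<partial>trajectory P \<pi> \<mu>) = measure_pmf.expectation (pair_law P \<pi> \<mu> n) f" (is ?B)
proof -
  have i: "integrable (measure_pmf (pair_law P \<pi> \<mu> n)) f"
    by (rule integrable_measure_pmf_finite) simp
  have e: "(\<integral>\<^sup>+\<omega>. ennreal (f (\<omega> n)) \<partial>trajectory P \<pi> \<mu>) = (\<integral>\<^sup>+x. ennreal (f x) \<partial>pair_law P \<pi> \<mu> n)"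
    by (rule nn_integral_trajectory[where f = "\<lambda>x. ennreal (f x)"])
  also have "\<dots> = ennreal (measure_pmf.expectation (pair_law P \<pi> \<mu> n) f)"
    using i f by (intro nn_integral_eq_integral) auto
  finally have e: "(\<integral>\<^sup>+\<omega>. ennreal (f (\<omega> n)) \<partial>trajectory P \<pi> \<mu>) = ennreal (measure_pmf.expectation (pair_law P \<pi> \<mu> n) f)" .
  show ?A
    using f e by (intro integrableI_nonneg measurable_trajectory_coordinate) auto
  show ?B
    using f e by (intro integral_eq_nn_integral[THEN trans] measurable_trajectory_coordinate)
      (auto intro!: integral_nonneg)
qed

text \<open>
  The return as a series in the laws of the chain, for an arbitrary law of the first state-action
  pair. It is affine in that law, which is what the Bellman equations rest on.
\<close>

definition expected_return ::
  "('s \<Rightarrow> 'a \<Rightarrow> 's pmf) \<Rightarrow> ('s \<Rightarrow> 'a \<Rightarrow> real) \<Rightarrow> real \<Rightarrow> ('s, 'a) policy \<Rightarrow> ('s \<times> 'a) pmf \<Rightarrow> real" where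
  "expected_return P r \<gamma> \<pi> \<mu> =
    (\<Sum>t. \<gamma> ^ t * measure_pmf.expectation (pair_law P \<pi> \<mu> t) (case_prod r))"

section \<open>Bellman backups and comparison principles\<close>

text \<open>
  Evaluated at a maximizer of \<open>f\<close>, the averaged term is at most the maximum itself. For a
  difference of two value functions this is the contraction property of the Bellman operators.
\<close>

lemma discounted_comparison:
  fixes f :: "'s::finite \<Rightarrow> real" and w :: "'s \<Rightarrow> 's pmf"
  assumes \<gamma>: "0 \<le> \<gamma>" "\<gamma> < 1"
    and f: "\<And>s. f s \<le> b + \<gamma> * (\<Sum>s'\<in>UNIV. pmf (w s) s' * f s')"
  shows "f s \<le> b / (1 - \<gamma>)"
proof -
  define m where "m = Max (range f)"
  have le_m: "f s \<le> m" for s unfolding m_def by simp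
  have "m \<in> range f" unfolding m_def by (rule Max_in) auto
  then obtain s0 where s0: "m = f s0" by auto
  have "(\<Sum>s'\<in>UNIV. pmf (w s0) s' * f s') \<le> (\<Sum>s'\<in>UNIV. pmf (w s0) s' * m)"
    by (intro sum_mono mult_left_mono le_m pmf_nonneg)
  also have "\<dots> = m"
    by (simp add: sum_distrib_right[symmetric] sum_pmf_eq_1)
  finally have "m \<le> b + \<gamma> * m"
    using f[of s0] \<gamma> unfolding s0[symmetric] by (smt (verit) mult_left_mono)
  then have "m \<le> b / (1 - \<gamma>)"
    using \<gamma> by (simp add: field_simps)
  with le_m[of s] show ?thesis by simp
qed

definition backup ::
  "('s::finite \<Rightarrow> 'a \<Rightarrow> 's pmf) \<Rightarrow> ('s \<Rightarrow> 'a \<Rightarrow> real) \<Rightarrow> real \<Rightarrow> ('s \<Rightarrow> real) \<Rightarrow> 's \<Rightarrow> 'a \<Rightarrow> real" where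
  "backup P r \<gamma> W s a = r s a + \<gamma> * (\<Sum>s'\<in>UNIV. pmf (P s a) s' * W s')"

text \<open>
  Rewards cancel in the difference, and what remains is the average under the state transition
  kernel \<open>bind_pmf p (P s)\<close> of the policy.
\<close>

lemma sum_pmf_backup_diff:
  fixes P :: "'s::finite \<Rightarrow> 'a::finite \<Rightarrow> 's pmf"
  shows "(\<Sum>a\<in>UNIV. pmf p a * backup P r \<gamma> V s a) - (\<Sum>a\<in>UNIV. pmf p a * backup P r \<gamma> W s a)
    = \<gamma> * (\<Sum>s'\<in>UNIV. pmf (bind_pmf p (P s)) s' * (V s' - W s'))"
proof -
  have "(\<Sum>s'\<in>UNIV. pmf (bind_pmf p (P s)) s' * (V s' - W s'))
      = measure_pmf.expectation (bind_pmf p (P s)) (\<lambda>s'. V s' - W s')"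
    by (simp add: integral_measure_pmf[of UNIV])
  also have "\<dots> = (\<Sum>a\<in>UNIV. pmf p a * (\<Sum>s'\<in>UNIV. pmf (P s a) s' * (V s' - W s')))"
    by (subst expectation_bind_finite) (simp add: integral_measure_pmf[of UNIV])
  finally show ?thesis
    by (simp add: backup_def sum_subtractf[symmetric] sum_distrib_left algebra_simps)
qed

lemma backup_mono:
  assumes "0 \<le> \<gamma>" "\<And>s'. V s' \<le> W s'"
  shows "backup P r \<gamma> V s a \<le> backup P r \<gamma> W s a"
  unfolding backup_def using assms by (intro add_left_mono mult_left_mono sum_mono) auto

section \<open>Bellman equations and optimal policies\<close>

locale discounted_mdp =
  fixes P :: "'s::finite \<Rightarrow> 'a::finite \<Rightarrow> 's pmf"
    and r :: "'s \<Rightarrow> 'a \<Rightarrow> real"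
    and \<gamma> :: real
  assumes reward: "\<And>s a. r s a \<in> {0..1}"
    and discount: "\<gamma> \<in> {0..<1}"
begin

lemma expectation_reward_bounds:
  "measure_pmf.expectation p (case_prod r) \<in> {0..1}"
proof -
  have "measure_pmf.expectation p (case_prod r) \<le> 1"
    using reward by (intro measure_pmf.integral_le_const integrable_measure_pmf_finite) (auto intro!: AE_I2)
  moreover have "0 \<le> measure_pmf.expectation p (case_prod r)"
    using reward by (intro Bochner_Integration.integral_nonneg) (auto split: prod.split)
  ultimately show ?thesis by simp
qed

lemma summable_expected_return:
  "summable (\<lambda>t. \<gamma> ^ t * measure_pmf.expectation (pair_law P \<pi> \<mu> t) (case_prod r))"
  using expectation_reward_bounds discount
  by (intro summable_comparison_test[OF _ summable_geometric[of \<gamma>]])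
     (auto intro!: exI[of _ 0] mult_left_le simp: abs_mult)

text \<open>
  Rewards lie in \<open>[0,1]\<close> and \<open>\<gamma> < 1\<close>, so the series of norms is dominated by a geometric series
  and the integral may be taken term by term.
\<close>

lemma integral_discounted_return:
  "(\<integral>\<omega>. discounted_return r \<gamma> \<omega> \<partial>trajectory P \<pi> \<mu>) = expected_return P r \<gamma> \<pi> \<mu>"
proof -
  let ?f = "\<lambda>t \<omega>. \<gamma> ^ t * r (fst (\<omega> t)) (snd (\<omega> t))"
  have nn: "0 \<le> \<gamma> ^ t * r (fst x) (snd x)" for t x
    using reward discount by simp
  have int: "integrable (trajectory P \<pi> \<mu>) (?f t)" for t
    by (rule integrable_trajectory[where f = "\<lambda>x. \<gamma> ^ t * r (fst x) (snd x)"]) (rule nn)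
  have val: "integral\<^sup>L (trajectory P \<pi> \<mu>) (?f t)
      = \<gamma> ^ t * measure_pmf.expectation (pair_law P \<pi> \<mu> t) (case_prod r)" for t
    using integral_trajectory[where f = "\<lambda>x. \<gamma> ^ t * r (fst x) (snd x)" and n = t, OF nn, of P \<pi> \<mu>] by (simp add: case_prod_unfold)
  have "summable (\<lambda>t. norm (?f t \<omega>))" for \<omega> :: "nat \<Rightarrow> 's \<times> 'a"
    using reward discount
    by (intro summable_comparison_test[OF _ summable_geometric[of \<gamma>]])
       (auto intro!: exI[of _ 0] mult_left_le simp: abs_mult)
  moreover have "summable (\<lambda>t. \<integral>\<omega>. norm (?f t \<omega>) \<partial>trajectory P \<pi> \<mu>)"
    using summable_expected_return[of \<pi> \<mu>] unfolding val[symmetric] real_norm_def abs_of_nonneg[OF nn] .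
  ultimately show ?thesis
    unfolding discounted_return_def expected_return_def
    using int by (subst integral_suminf) (auto simp only: val)
qed

lemma pair_law_bind:
  "pair_law P \<pi> (bind_pmf \<mu> f) n = bind_pmf \<mu> (\<lambda>x. pair_law P \<pi> (f x) n)"
  by (induction n) (simp_all add: bind_assoc_pmf)

lemma pair_law_Suc: "pair_law P \<pi> \<mu> (Suc n) = pair_law P \<pi> (bind_pmf \<mu> (next_pair P \<pi>)) n"
  by (induction n) simp_all

lemma expected_return_mix:
  "expected_return P r \<gamma> \<pi> \<mu>
    = measure_pmf.expectation \<mu> (\<lambda>x. expected_return P r \<gamma> \<pi> (return_pmf x))"
proof -
  have "expected_return P r \<gamma> \<pi> \<mu> = (\<Sum>t. \<Sum>x\<in>UNIV. pmf \<mu> x * (\<gamma> ^ t *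
      measure_pmf.expectation (pair_law P \<pi> (return_pmf x) t) (case_prod r)))"
    unfolding expected_return_def
    using pair_law_bind[of \<pi> \<mu> return_pmf]
    by (simp add: bind_return_pmf' expectation_bind_finite integral_measure_pmf[of UNIV]
        sum_distrib_left mult_ac)
  also have "\<dots> = (\<Sum>x\<in>UNIV. \<Sum>t. pmf \<mu> x * (\<gamma> ^ t *
      measure_pmf.expectation (pair_law P \<pi> (return_pmf x) t) (case_prod r)))"
    by (intro suminf_sum summable_mult summable_expected_return)
  also have "\<dots> = (\<Sum>x\<in>UNIV. pmf \<mu> x * expected_return P r \<gamma> \<pi> (return_pmf x))"
    unfolding expected_return_def
    by (intro sum.cong refl suminf_mult summable_expected_return)
  finally show ?thesis
    by (simp add: integral_measure_pmf[of UNIV])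
qed

lemma expected_return_unfold:
  "expected_return P r \<gamma> \<pi> \<mu> = measure_pmf.expectation \<mu> (case_prod r)
    + \<gamma> * expected_return P r \<gamma> \<pi> (bind_pmf \<mu> (next_pair P \<pi>))"
proof -
  let ?g = "\<lambda>t. \<gamma> ^ t * measure_pmf.expectation (pair_law P \<pi> \<mu> t) (case_prod r)"
  have "expected_return P r \<gamma> \<pi> \<mu> = ?g 0 + (\<Sum>t. ?g (Suc t))"
    unfolding expected_return_def using suminf_split_head[OF summable_expected_return] by simp
  also have "(\<Sum>t. ?g (Suc t)) = (\<Sum>t. \<gamma> * (\<gamma> ^ t * measure_pmf.expectation
      (pair_law P \<pi> (bind_pmf \<mu> (next_pair P \<pi>)) t) (case_prod r)))"
    by (simp only: pair_law_Suc power_Suc mult.assoc)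
  also have "\<dots> = \<gamma> * expected_return P r \<gamma> \<pi> (bind_pmf \<mu> (next_pair P \<pi>))"
    unfolding expected_return_def by (rule suminf_mult[OF summable_expected_return])
  finally show ?thesis by simp
qed

lemma V_fun_eq: "V_fun P r \<gamma> \<pi> s = (\<Sum>a\<in>UNIV. pmf (\<pi> s) a * Q_fun P r \<gamma> \<pi> s a)"
  unfolding V_fun_def Q_fun_def integral_discounted_return
  by (subst expected_return_mix) (simp add: integral_measure_pmf[of UNIV])

lemma Q_fun_eq:
  "Q_fun P r \<gamma> \<pi> s a = r s a + \<gamma> * (\<Sum>s'\<in>UNIV. pmf (P s a) s' * V_fun P r \<gamma> \<pi> s')"
proof -
  have "Q_fun P r \<gamma> \<pi> s a = r s a + \<gamma> * expected_return P r \<gamma> \<pi> (next_pair P \<pi> (s, a))"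
    unfolding Q_fun_def integral_discounted_return
    by (subst expected_return_unfold) (simp add: bind_return_pmf)
  also have "expected_return P r \<gamma> \<pi> (next_pair P \<pi> (s, a))
      = (\<Sum>s'\<in>UNIV. pmf (P s a) s' * V_fun P r \<gamma> \<pi> s')"
    unfolding V_fun_def integral_discounted_return
    apply (subst expected_return_mix)
    apply (subst (2) expected_return_mix)
    apply (simp add: next_pair_def expectation_bind_finite)
    apply (simp add: integral_measure_pmf[of UNIV])
    done
  finally show ?thesis .
qed

lemma Q_fun_eq_backup: "Q_fun P r \<gamma> \<pi> = backup P r \<gamma> (V_fun P r \<gamma> \<pi>)"
  by (intro ext) (simp add: backup_def Q_fun_eq)

text \<open>
  A supersolution of the Bellman equation of \<open>\<pi>\<close> dominates its value: the difference satisfies the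
  comparison principle with \<open>b = 0\<close>.
\<close>

lemma V_fun_le:
  assumes "\<And>s. (\<Sum>a\<in>UNIV. pmf (\<pi> s) a * backup P r \<gamma> W s a) \<le> W s"
  shows "V_fun P r \<gamma> \<pi> s \<le> W s"
proof -
  let ?f = "\<lambda>s. V_fun P r \<gamma> \<pi> s - W s"
  have "?f s \<le> 0 / (1 - \<gamma>)"
  proof (rule discounted_comparison)
    fix s
    have "V_fun P r \<gamma> \<pi> s = (\<Sum>a\<in>UNIV. pmf (\<pi> s) a * backup P r \<gamma> (V_fun P r \<gamma> \<pi>) s a)"
      by (simp add: V_fun_eq Q_fun_eq_backup)
    then show "?f s \<le> 0 + \<gamma> * (\<Sum>s'\<in>UNIV. pmf (bind_pmf (\<pi> s) (P s)) s' * ?f s')"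
      using assms[of s] sum_pmf_backup_diff[of "\<pi> s" P r \<gamma> "V_fun P r \<gamma> \<pi>" s W] by linarith
  qed (use discount in auto)
  then show ?thesis by simp
qed

lemma V_fun_ge:
  assumes "\<And>s. W s \<le> (\<Sum>a\<in>UNIV. pmf (\<pi> s) a * backup P r \<gamma> W s a)"
  shows "W s \<le> V_fun P r \<gamma> \<pi> s"
proof -
  let ?f = "\<lambda>s. W s - V_fun P r \<gamma> \<pi> s"
  have "?f s \<le> 0 / (1 - \<gamma>)"
  proof (rule discounted_comparison)
    fix s
    have "V_fun P r \<gamma> \<pi> s = (\<Sum>a\<in>UNIV. pmf (\<pi> s) a * backup P r \<gamma> (V_fun P r \<gamma> \<pi>) s a)"
      by (simp add: V_fun_eq Q_fun_eq_backup)
    then show "?f s \<le> 0 + \<gamma> * (\<Sum>s'\<in>UNIV. pmf (bind_pmf (\<pi> s) (P s)) s' * ?f s')"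
      using assms[of s] sum_pmf_backup_diff[of "\<pi> s" P r \<gamma> W s "V_fun P r \<gamma> \<pi>"] by linarith
  qed (use discount in auto)
  then show ?thesis by simp
qed

lemma V_fun_bounds: "0 \<le> V_fun P r \<gamma> \<pi> s" "V_fun P r \<gamma> \<pi> s \<le> 1 / (1 - \<gamma>)"
proof -
  show "0 \<le> V_fun P r \<gamma> \<pi> s"
    by (rule V_fun_ge[where W = "\<lambda>_. 0"])
       (use reward in \<open>auto simp: backup_def intro!: sum_nonneg\<close>)
  show "V_fun P r \<gamma> \<pi> s \<le> 1 / (1 - \<gamma>)"
  proof (rule V_fun_le[where W = "\<lambda>_. 1 / (1 - \<gamma>)"])
    fix s
    have "backup P r \<gamma> (\<lambda>_. 1 / (1 - \<gamma>)) s a \<le> 1 / (1 - \<gamma>)" for a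
    proof -
      have "backup P r \<gamma> (\<lambda>_. 1 / (1 - \<gamma>)) s a = r s a + \<gamma> / (1 - \<gamma>)"
        by (simp add: backup_def sum_divide_distrib[symmetric] sum_pmf_eq_1)
      also have "\<dots> \<le> 1 + \<gamma> / (1 - \<gamma>)" using reward by auto
      also have "\<dots> = 1 / (1 - \<gamma>)" using discount by (simp add: field_simps)
      finally show ?thesis .
    qed
    then have "(\<Sum>a\<in>UNIV. pmf (\<pi> s) a * backup P r \<gamma> (\<lambda>_. 1 / (1 - \<gamma>)) s a)
        \<le> (\<Sum>a\<in>UNIV. pmf (\<pi> s) a * (1 / (1 - \<gamma>)))"
      by (intro sum_mono mult_left_mono) auto
    also have "\<dots> = 1 / (1 - \<gamma>)"
      by (simp only: sum_distrib_right[symmetric] sum_pmf_eq_1[OF finite subset_UNIV] mult_1)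
    finally show "(\<Sum>a\<in>UNIV. pmf (\<pi> s) a * backup P r \<gamma> (\<lambda>_. 1 / (1 - \<gamma>)) s a) \<le> 1 / (1 - \<gamma>)" .
  qed
qed

text \<open>
  Among the finitely many deterministic policies take one that maximizes the sum of its values over
  all states. If an action had a larger action value at some state, switching to it there would
  increase that sum.
\<close>

lemma ex_greedy_policy:
  "\<exists>\<pi>. \<forall>s a. Q_fun P r \<gamma> \<pi> s a \<le> V_fun P r \<gamma> \<pi> s"
proof -
  define V where "V d = V_fun P r \<gamma> (\<lambda>s. return_pmf (d s))" for d :: "'s \<Rightarrow> 'a"
  define S where "S d = (\<Sum>s\<in>UNIV. V d s)" for d
  have "Max (range S) \<in> range S" by (rule Max_in) auto
  then obtain d where d: "Max (range S) = S d" by blast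
  have max: "S d' \<le> S d" for d' unfolding d[symmetric] by simp
  have V: "V d s = backup P r \<gamma> (V d) s (d s)" for d s
    unfolding V_def V_fun_eq[where s = s] Q_fun_eq_backup
    by (simp add: indicator_def)
  have "backup P r \<gamma> (V d) s a \<le> V d s" for s a
  proof (rule ccontr)
    assume less: "\<not> ?thesis"
    define d' where "d' = d(s := a)"
    have ge: "V d t \<le> V d' t" for t
      unfolding V_def[of d']
    proof (rule V_fun_ge)
      fix t
      have "V d t \<le> backup P r \<gamma> (V d) t (d' t)"
        using less V[of d t] by (auto simp: d'_def)
      then show "V d t \<le> (\<Sum>a\<in>UNIV. pmf (return_pmf (d' t)) a * backup P r \<gamma> (V d) t a)"
        by (simp add: indicator_def)
    qed
    have "V d s < backup P r \<gamma> (V d) s (d' s)"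
      using less by (simp add: d'_def)
    also have "\<dots> \<le> V d' s"
      unfolding V[of d' s] by (intro backup_mono ge) (use discount in auto)
    finally have "S d < S d'"
      unfolding S_def by (intro sum_strict_mono_ex1) (auto intro: ge)
    with max[of d'] show False by simp
  qed
  then show ?thesis
    unfolding V_def Q_fun_eq_backup by blast
qed

text \<open>
  The value of a greedy policy is a supersolution of the Bellman equation of every other policy, hence
  an upper bound that is attained. The suprema over all policies are therefore values of one policy.
\<close>

lemma ex_optimal_policy:
  "\<exists>\<pi>. V_fun P r \<gamma> \<pi> = V_opt P r \<gamma> \<and> Q_fun P r \<gamma> \<pi> = Q_opt P r \<gamma>
    \<and> (\<forall>s a. Q_opt P r \<gamma> s a \<le> V_opt P r \<gamma> s)"
proof -
  obtain \<pi> where \<pi>: "\<And>s a. Q_fun P r \<gamma> \<pi> s a \<le> V_fun P r \<gamma> \<pi> s"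
    using ex_greedy_policy by blast
  have V_le: "V_fun P r \<gamma> \<pi>' s \<le> V_fun P r \<gamma> \<pi> s" for \<pi>' s
  proof (rule V_fun_le)
    fix s
    have "(\<Sum>a\<in>UNIV. pmf (\<pi>' s) a * backup P r \<gamma> (V_fun P r \<gamma> \<pi>) s a)
        \<le> (\<Sum>a\<in>UNIV. pmf (\<pi>' s) a * V_fun P r \<gamma> \<pi> s)"
      using \<pi> unfolding Q_fun_eq_backup by (intro sum_mono mult_left_mono) auto
    then show "(\<Sum>a\<in>UNIV. pmf (\<pi>' s) a * backup P r \<gamma> (V_fun P r \<gamma> \<pi>) s a) \<le> V_fun P r \<gamma> \<pi> s"
      by (simp add: sum_distrib_right[symmetric] sum_pmf_eq_1)
  qed
  have Q_le: "Q_fun P r \<gamma> \<pi>' s a \<le> Q_fun P r \<gamma> \<pi> s a" for \<pi>' s a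
    unfolding Q_fun_eq_backup by (intro backup_mono V_le) (use discount in auto)
  have V: "V_fun P r \<gamma> \<pi> = V_opt P r \<gamma>"
    unfolding V_opt_def by (intro ext cSup_eq_maximum[symmetric]) (auto intro: V_le)
  have Q: "Q_fun P r \<gamma> \<pi> = Q_opt P r \<gamma>"
    unfolding Q_opt_def by (intro ext cSup_eq_maximum[symmetric]) (auto intro: Q_le)
  from \<pi> V Q show ?thesis by auto
qed

lemma Q_opt_eq_backup: "Q_opt P r \<gamma> = backup P r \<gamma> (V_opt P r \<gamma>)"
  using ex_optimal_policy Q_fun_eq_backup by metis

lemma Q_opt_le_V_opt: "Q_opt P r \<gamma> s a \<le> V_opt P r \<gamma> s"
  using ex_optimal_policy by blast

lemma V_fun_le_V_opt: "V_fun P r \<gamma> \<pi> s \<le> V_opt P r \<gamma> s"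
proof (rule V_fun_le)
  fix s
  have "(\<Sum>a\<in>UNIV. pmf (\<pi> s) a * backup P r \<gamma> (V_opt P r \<gamma>) s a)
      \<le> (\<Sum>a\<in>UNIV. pmf (\<pi> s) a * V_opt P r \<gamma> s)"
    using Q_opt_le_V_opt unfolding Q_opt_eq_backup by (intro sum_mono mult_left_mono) auto
  then show "(\<Sum>a\<in>UNIV. pmf (\<pi> s) a * backup P r \<gamma> (V_opt P r \<gamma>) s a) \<le> V_opt P r \<gamma> s"
    by (simp add: sum_distrib_right[symmetric] sum_pmf_eq_1)
qed

lemma Q_fun_le_Q_opt: "Q_fun P r \<gamma> \<pi> s a \<le> Q_opt P r \<gamma> s a"
  unfolding Q_fun_eq_backup Q_opt_eq_backup
  by (intro backup_mono V_fun_le_V_opt) (use discount in auto)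

lemma Q_fun_near_Q_opt:
  assumes "\<And>s. V_opt P r \<gamma> s - V_fun P r \<gamma> \<pi> s \<le> c"
  shows "Q_opt P r \<gamma> s a - Q_fun P r \<gamma> \<pi> s a \<le> c"
proof -
  have "0 \<le> c" using assms[of undefined] V_fun_le_V_opt[of \<pi> undefined] by linarith
  have "Q_opt P r \<gamma> s a - Q_fun P r \<gamma> \<pi> s a
      = \<gamma> * (\<Sum>s'\<in>UNIV. pmf (P s a) s' * (V_opt P r \<gamma> s' - V_fun P r \<gamma> \<pi> s'))"
    unfolding Q_fun_eq_backup Q_opt_eq_backup
    by (simp add: backup_def algebra_simps sum_subtractf)
  also have "\<dots> \<le> \<gamma> * (\<Sum>s'\<in>UNIV. pmf (P s a) s' * c)"
    by (intro mult_left_mono sum_mono assms) (use discount in auto)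
  also have "\<dots> = \<gamma> * c" by (simp add: sum_distrib_right[symmetric] sum_pmf_eq_1)
  also have "\<dots> \<le> c"
    using discount \<open>0 \<le> c\<close> by (auto intro!: mult_left_le_one_le)
  finally show ?thesis .
qed

text \<open>
  \<open>V\<^sup>*(s)\<close> is an upper bound for \<open>Q\<^sup>*(s,\<cdot>)\<close>, and for an optimal policy it is also an average of
  it, which forces equality on the support. Conversely, support on optimal actions makes \<open>V\<^sup>*\<close> a
  solution of the Bellman equation of the policy.
\<close>

lemma optimal_policies_iff:
  "\<pi> \<in> optimal_policies P r \<gamma> \<longleftrightarrow> (\<forall>s a. pmf (\<pi> s) a > 0 \<longrightarrow> a \<in> optimal_actions P r \<gamma> s)"
proof
  assume "\<pi> \<in> optimal_policies P r \<gamma>"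
  then have V: "V_fun P r \<gamma> \<pi> = V_opt P r \<gamma>" by (simp add: optimal_policies_def)
  show "\<forall>s a. pmf (\<pi> s) a > 0 \<longrightarrow> a \<in> optimal_actions P r \<gamma> s"
  proof (intro allI impI)
    fix s a assume pos: "pmf (\<pi> s) a > 0"
    have "(\<Sum>a\<in>UNIV. pmf (\<pi> s) a * (V_opt P r \<gamma> s - Q_opt P r \<gamma> s a))
        = V_opt P r \<gamma> s - (\<Sum>a\<in>UNIV. pmf (\<pi> s) a * Q_opt P r \<gamma> s a)"
      by (simp add: right_diff_distrib sum_subtractf sum_distrib_right[symmetric] sum_pmf_eq_1)
    also have "\<dots> = 0"
      using V_fun_eq[where \<pi> = \<pi> and s = s]
      by (simp add: V Q_fun_eq_backup Q_opt_eq_backup)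
    finally have "pmf (\<pi> s) a * (V_opt P r \<gamma> s - Q_opt P r \<gamma> s a) = 0"
      using Q_opt_le_V_opt by (subst (asm) sum_nonneg_eq_0_iff) auto
    with pos show "a \<in> optimal_actions P r \<gamma> s" by (simp add: optimal_actions_def)
  qed
next
  assume *: "\<forall>s a. pmf (\<pi> s) a > 0 \<longrightarrow> a \<in> optimal_actions P r \<gamma> s"
  have eq: "(\<Sum>a\<in>UNIV. pmf (\<pi> s) a * backup P r \<gamma> (V_opt P r \<gamma>) s a) = V_opt P r \<gamma> s" for s
  proof -
    have "pmf (\<pi> s) a * Q_opt P r \<gamma> s a = pmf (\<pi> s) a * V_opt P r \<gamma> s" for a
    proof (cases "pmf (\<pi> s) a = 0")
      case False
      then have "pmf (\<pi> s) a > 0" by (simp add: less_le)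
      with * show ?thesis by (simp add: optimal_actions_def)
    qed simp
    then have "(\<Sum>a\<in>UNIV. pmf (\<pi> s) a * Q_opt P r \<gamma> s a) = (\<Sum>a\<in>UNIV. pmf (\<pi> s) a * V_opt P r \<gamma> s)"
      by (rule sum.cong[OF refl])
    then show ?thesis
      unfolding Q_opt_eq_backup[symmetric]
      by (simp add: sum_distrib_right[symmetric] sum_pmf_eq_1)
  qed
  have "V_opt P r \<gamma> s \<le> V_fun P r \<gamma> \<pi> s" for s
    by (rule V_fun_ge) (simp add: eq)
  with V_fun_le_V_opt[of \<pi>] show "\<pi> \<in> optimal_policies P r \<gamma>"
    by (auto simp: optimal_policies_def intro!: ext antisym)
qed

lemma ex_optimal_action: "\<exists>a. a \<in> optimal_actions P r \<gamma> s"
proof -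
  obtain \<pi> where "\<pi> \<in> optimal_policies P r \<gamma>"
    using ex_optimal_policy by (auto simp: optimal_policies_def)
  moreover obtain a where "a \<in> set_pmf (\<pi> s)" using set_pmf_not_empty by fast
  ultimately show ?thesis
    unfolding optimal_policies_iff using pmf_positive by fast
qed

lemma Q_opt_le_minus_gap:
  assumes "a \<notin> optimal_actions P r \<gamma> s"
  shows "Q_opt P r \<gamma> s a \<le> V_opt P r \<gamma> s - gap P r \<gamma>"
proof -
  have "s \<in> nontrivial_states P r \<gamma>" using assms by (auto simp: nontrivial_states_def)
  then have "gap P r \<gamma> \<le> state_gap P r \<gamma> s" unfolding gap_def by (intro Min_le) auto
  moreover have "Q_opt P r \<gamma> s a \<le> (MAX a'\<in>- optimal_actions P r \<gamma> s. Q_opt P r \<gamma> s a')"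
    using assms by (intro Max_ge) auto
  ultimately show ?thesis by (simp add: state_gap_def)
qed

lemma gap_pos:
  assumes "nontrivial_states P r \<gamma> \<noteq> {}"
  shows "gap P r \<gamma> > 0"
proof -
  have "state_gap P r \<gamma> s > 0" if s: "s \<in> nontrivial_states P r \<gamma>" for s
  proof -
    have "(MAX a'\<in>- optimal_actions P r \<gamma> s. Q_opt P r \<gamma> s a')
        \<in> (\<lambda>a'. Q_opt P r \<gamma> s a') ` (- optimal_actions P r \<gamma> s)"
      using s by (intro Max_in) (auto simp: nontrivial_states_def)
    then obtain a where "a \<notin> optimal_actions P r \<gamma> s"
      "(MAX a'\<in>- optimal_actions P r \<gamma> s. Q_opt P r \<gamma> s a') = Q_opt P r \<gamma> s a"
      by auto
    with Q_opt_le_V_opt[of s a] show ?thesis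
      by (auto simp: state_gap_def optimal_actions_def)
  qed
  then show ?thesis
    unfolding gap_def using assms by (subst Min_gr_iff) auto
qed

end

section \<open>Mirror maps on the line\<close>

locale mirror =
  fixes \<psi> :: "real \<Rightarrow> ereal"
  assumes mirror: "mirror_map \<psi>"
begin

text \<open>
  On the domain of \<open>\<psi>\<close> the real-valued \<open>\<phi>\<close> carries the same information; off it, its value is an
  artefact of the conversion from the extended reals.
\<close>

abbreviation \<phi> :: "real \<Rightarrow> real" where "\<phi> x \<equiv> real_of_ereal (\<psi> x)"
abbreviation Int_dom :: "real set" where "Int_dom \<equiv> interior (edom \<psi>)"

lemma mirror_finite:
  assumes "x \<in> edom \<psi>" shows "\<psi> x = ereal (\<phi> x)"
  using assms mirror by (cases "\<psi> x") (auto simp: edom_def mirror_map_def)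

lemma mirror_convex_combination:
  assumes "x \<in> edom \<psi>" "y \<in> edom \<psi>" "0 \<le> u" "u \<le> 1"
  shows "\<psi> ((1 - u) * x + u * y) \<le> ereal ((1 - u) * \<phi> x + u * \<phi> y)"
proof -
  have "convex (eepigraph \<psi>)" using mirror by (simp add: mirror_map_def)
  moreover have "(x, \<phi> x) \<in> eepigraph \<psi>" "(y, \<phi> y) \<in> eepigraph \<psi>"
    using mirror_finite assms by (auto simp: eepigraph_def)
  ultimately have "(1 - u) *\<^sub>R (x, \<phi> x) + u *\<^sub>R (y, \<phi> y) \<in> eepigraph \<psi>"
    using assms by (intro convexD_alt) auto
  then show ?thesis by (simp add: eepigraph_def)
qed

lemma convex_mirror_domain: "convex (edom \<psi>)"
proof -
  have "\<psi> ((1 - u) * x + u * y) < \<infinity>"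
    if "x \<in> edom \<psi>" "y \<in> edom \<psi>" "0 \<le> u" "u \<le> 1" for x y u
    using mirror_convex_combination[OF that] by (rule order.strict_trans1) simp
  then show ?thesis
    unfolding convex_alt by (simp add: edom_def)
qed

lemma convex_on_mirror: "convex_on Int_dom \<phi>"
proof (rule convex_onI)
  show "convex Int_dom" by (rule convex_interior[OF convex_mirror_domain])
  fix t x y :: real
  assume *: "0 < t" "t < 1" "x \<in> Int_dom" "y \<in> Int_dom"
  then have xy: "x \<in> edom \<psi>" "y \<in> edom \<psi>" using interior_subset by auto
  then have "(1 - t) *\<^sub>R x + t *\<^sub>R y \<in> edom \<psi>"
    using convex_mirror_domain * by (intro convexD_alt) auto
  then have "\<psi> ((1 - t) * x + t * y) = ereal (\<phi> ((1 - t) * x + t * y))"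
    using mirror_finite by simp
  then have "ereal (\<phi> ((1 - t) * x + t * y)) \<le> ereal ((1 - t) * \<phi> x + t * \<phi> y)"
    using mirror_convex_combination[OF xy, of t] * by (metis less_imp_le)
  then show "\<phi> ((1 - t) *\<^sub>R x + t *\<^sub>R y) \<le> (1 - t) * \<phi> x + t * \<phi> y"
    by simp
qed

lemma mirror_has_derivative:
  assumes "x \<in> Int_dom" shows "(\<phi> has_real_derivative ederiv \<psi> x) (at x)"
  unfolding ederiv_def
  using assms mirror by (auto simp: mirror_map_def field_differentiable_def real_differentiable_def
      intro!: DERIV_deriv_iff_field_differentiable[THEN iffD2])

lemma mirror_above_tangent:
  assumes "x \<in> Int_dom" "y \<in> Int_dom"
  shows "\<phi> x + ederiv \<psi> x * (y - x) \<le> \<phi> y"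
proof -
  have "ederiv \<psi> x * (y - x) \<le> \<phi> y - \<phi> x"
    by (rule convex_on_imp_above_tangent[OF convex_on_mirror])
       (use assms convex_interior[OF convex_mirror_domain] in
         \<open>auto intro!: convex_connected has_field_derivative_at_within[OF mirror_has_derivative]
            simp: interior_interior\<close>)
  then show ?thesis by simp
qed

text \<open>
  Strictness comes from the midpoint \<open>m\<close>: its value lies strictly below the chord, but
  still above the tangent at \<open>x\<close>.
\<close>

lemma mirror_strictly_above_tangent:
  assumes x: "x \<in> Int_dom" and y: "y \<in> Int_dom" and "x \<noteq> y"
  shows "\<phi> x + ederiv \<psi> x * (y - x) < \<phi> y"
proof -
  define m where "m = (x + y) / 2"
  have m': "(1 - 1/2) *\<^sub>R x + (1/2) *\<^sub>R y = m" by (simp add: m_def field_simps)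
  have m: "m \<in> Int_dom"
    using convexD_alt[OF convex_interior[OF convex_mirror_domain] x y, of "1/2"] m' by simp
  have "\<psi> ((1 - 1/2) * x + (1/2) * y) < ereal (1 - 1/2) * \<psi> x + ereal (1/2) * \<psi> y"
    using mirror assms unfolding mirror_map_def by (metis greaterThanLessThan_iff half_gt_zero_iff
        zero_less_one one_less_numeral_iff semiring_norm(76) divide_less_eq_1_pos zero_less_numeral)
  then have "\<psi> m < ereal (1/2) * \<psi> x + ereal (1/2) * \<psi> y"
    using m' by simp
  also have "\<dots> = ereal ((\<phi> x + \<phi> y) / 2)"
    using x y interior_subset[of "edom \<psi>"]
    by (subst (1 2) mirror_finite) (auto simp: field_simps)
  finally have "\<psi> m < ereal ((\<phi> x + \<phi> y) / 2)" .
  moreover have "\<psi> m = ereal (\<phi> m)"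
    using m interior_subset[of "edom \<psi>"] by (intro mirror_finite) auto
  ultimately have "\<phi> m < (\<phi> x + \<phi> y) / 2"
    by (metis ereal_less_eq(3) not_le)
  moreover have "\<phi> x + ederiv \<psi> x * (m - x) \<le> \<phi> m"
    by (rule mirror_above_tangent[OF x m])
  moreover have "m - x = (y - x) / 2" by (simp add: m_def field_simps)
  ultimately show ?thesis by simp
qed

lemma mirror_deriv_strict_mono:
  assumes "x \<in> Int_dom" "y \<in> Int_dom" "x < y"
  shows "ederiv \<psi> x < ederiv \<psi> y"
proof -
  have "\<phi> x + ederiv \<psi> x * (y - x) < \<phi> y" "\<phi> y + ederiv \<psi> y * (x - y) < \<phi> x"
    using assms by (auto intro!: mirror_strictly_above_tangent)
  then have "ederiv \<psi> x * (y - x) < ederiv \<psi> y * (y - x)"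
    by (simp add: algebra_simps)
  with assms show ?thesis by simp
qed

lemma mirror_deriv_mono:
  assumes "x \<in> Int_dom" "y \<in> Int_dom" "x \<le> y"
  shows "ederiv \<psi> x \<le> ederiv \<psi> y"
  using assms mirror_deriv_strict_mono[of x y] by (cases "x = y") auto

text \<open>
  The tangents at \<open>c\<close> and at \<open>c + h\<close>, evaluated at \<open>c + h\<close> and \<open>c + 2h\<close>, squeeze the derivative at
  \<open>c + h\<close> between \<open>\<psi>'(c)\<close> and \<open>2 q(2h) - \<psi>'(c)\<close>, where \<open>q\<close> is the difference quotient at \<open>c\<close>.
\<close>

lemma mirror_deriv_continuous:
  assumes c: "c \<in> Int_dom"
  shows "isCont (ederiv \<psi>) c"
proof -
  let ?q = "\<lambda>h. (\<phi> (c + h) - \<phi> c) / h"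
  have "(?q \<longlongrightarrow> ederiv \<psi> c) (at 0)"
    using mirror_has_derivative[OF c] by (simp add: DERIV_def)
  moreover have "filterlim (\<lambda>h::real. 2 * h) (at 0) (at 0)"
    by (auto simp: filterlim_at eventually_at_filter intro!: tendsto_eq_intros)
  ultimately have "((\<lambda>h. ?q (2 * h)) \<longlongrightarrow> ederiv \<psi> c) (at 0)"
    by (rule filterlim_compose)
  then have "((\<lambda>h. 2 * (?q (2 * h) - ederiv \<psi> c)) \<longlongrightarrow> 2 * (ederiv \<psi> c - ederiv \<psi> c)) (at 0)"
    by (intro tendsto_intros)
  then have lim: "((\<lambda>h. 2 * (?q (2 * h) - ederiv \<psi> c)) \<longlongrightarrow> 0) (at 0)"
    by simp
  obtain e where e: "e > 0" "ball c e \<subseteq> Int_dom"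
    using open_contains_ball[of Int_dom] c by auto
  have "norm (ederiv \<psi> (c + h) - ederiv \<psi> c) \<le> norm (2 * (?q (2 * h) - ederiv \<psi> c))"
    if h: "h \<noteq> 0" "2 * \<bar>h\<bar> < e" for h
  proof -
    have in_D: "c + h \<in> Int_dom" "c + 2 * h \<in> Int_dom"
      using e h by (auto simp: subset_iff dist_real_def)
    have t1: "\<phi> (c + h) + ederiv \<psi> (c + h) * h \<le> \<phi> (c + 2 * h)"
      using mirror_above_tangent[OF in_D] by simp
    have t2: "\<phi> c + ederiv \<psi> c * h \<le> \<phi> (c + h)"
      using mirror_above_tangent[OF c in_D(1)] by simp
    have upper: "(ederiv \<psi> (c + h) - ederiv \<psi> c) * h \<le> 2 * (?q (2 * h) - ederiv \<psi> c) * h"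
    proof -
      define q where "q = ?q (2 * h)"
      have "q * (2 * h) = \<phi> (c + 2 * h) - \<phi> c" using h by (simp add: q_def)
      with t1 t2 show ?thesis unfolding q_def[symmetric] by (simp add: algebra_simps)
    qed
    have "0 \<le> (ederiv \<psi> (c + h) - ederiv \<psi> c) * h"
      using mirror_deriv_strict_mono[OF c in_D(1)] mirror_deriv_strict_mono[OF in_D(1) c] h
      by (cases "h > 0") (auto intro: mult_nonneg_nonneg mult_nonpos_nonpos)
    then have "\<bar>(ederiv \<psi> (c + h) - ederiv \<psi> c) * h\<bar> \<le> \<bar>2 * (?q (2 * h) - ederiv \<psi> c) * h\<bar>"
      using upper by linarith
    then show ?thesis using h unfolding abs_mult[of _ h] real_norm_def by simp
  qed
  then have "\<forall>\<^sub>F h in at 0. norm (ederiv \<psi> (c + h) - ederiv \<psi> c) \<le> norm (2 * (?q (2 * h) - ederiv \<psi> c))"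
    unfolding eventually_at using e(1) by (intro exI[of _ "e/2"]) (auto simp: dist_real_def)
  then have "((\<lambda>h. ederiv \<psi> (c + h) - ederiv \<psi> c) \<longlongrightarrow> 0) (at 0)"
    by (rule Lim_null_comparison[OF _ tendsto_norm_zero[OF lim]])
  then have "((\<lambda>h. ederiv \<psi> (c + h)) \<longlongrightarrow> ederiv \<psi> c) (at 0)"
    by (simp add: LIM_zero_iff)
  then show ?thesis by (simp add: isCont_iff)
qed

lemma unit_interval_subset_domain: "{0..1} \<subseteq> edom \<psi>"
  using mirror by (simp add: mirror_map_def)

lemma open_unit_interval_subset: "{0<..<1} \<subseteq> Int_dom"
  using interior_mono[OF unit_interval_subset_domain] by (simp add: interior_atLeastAtMost_real)

lemma mirror_deriv_blows_up:
  assumes "c \<in> edom \<psi>" "c \<notin> Int_dom" "\<And>n. X n \<in> Int_dom" "X \<longlonglongrightarrow> c"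
  shows "filterlim (\<lambda>n. \<bar>ederiv \<psi> (X n)\<bar>) at_top sequentially"
proof -
  have "c \<in> frontier (edom \<psi>)"
    using assms closure_subset[of "edom \<psi>"] by (auto simp: frontier_def)
  with assms mirror show ?thesis unfolding mirror_map_def by blast
qed

text \<open>
  Otherwise \<open>0\<close> is a boundary point of the domain, so \<open>\<bar>\<psi>'\<bar>\<close> is unbounded near it; as \<open>\<psi>'\<close> is
  increasing, it must tend to \<open>-\<infinity>\<close> there.
\<close>

lemma zero_in_domain:
  assumes "ederiv_right0 \<psi> > - \<infinity>" shows "0 \<in> Int_dom"
proof (rule ccontr)
  assume not: "0 \<notin> Int_dom"
  define X :: "nat \<Rightarrow> real" where "X n = 1 / (real n + 2)" for n
  have X: "X n \<in> {0<..1/2}" for n by (auto simp: X_def field_simps)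
  have XD: "X n \<in> Int_dom" for n
    using X[of n] open_unit_interval_subset by (auto simp: subset_iff)
  have "X \<longlonglongrightarrow> 0"
    unfolding X_def by real_asymp
  with not XD unit_interval_subset_domain
  have inf: "filterlim (\<lambda>n. \<bar>ederiv \<psi> (X n)\<bar>) at_top sequentially"
    by (intro mirror_deriv_blows_up) auto
  have "((\<lambda>x. ereal (ederiv \<psi> x)) \<longlongrightarrow> - \<infinity>) (at_right 0)"
    unfolding tendsto_MInfty
  proof
    fix B :: real
    have "eventually (\<lambda>n. \<bar>B\<bar> + \<bar>ederiv \<psi> (1/2)\<bar> < \<bar>ederiv \<psi> (X n)\<bar>) sequentially"
      using inf by (simp add: filterlim_at_top_dense)
    then obtain n where n: "\<bar>B\<bar> + \<bar>ederiv \<psi> (1/2)\<bar> < \<bar>ederiv \<psi> (X n)\<bar>"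
      by (auto simp: eventually_sequentially)
    have "ederiv \<psi> (X n) \<le> ederiv \<psi> (1/2)"
      using X[of n] mirror_deriv_mono[OF XD, of "1/2" n] open_unit_interval_subset
      by (auto simp: subset_iff)
    with n have less: "ederiv \<psi> (X n) < B" by linarith
    have "ederiv \<psi> x < B" if "0 < x" "x < X n" for x
      using mirror_deriv_strict_mono[OF _ XD, of x n] that X[of n] open_unit_interval_subset less
      by (fastforce simp: subset_iff)
    then show "\<forall>\<^sub>F x in at_right 0. ereal (ederiv \<psi> x) < ereal B"
      unfolding eventually_at_right_field using X[of n] by auto
  qed
  then have "ederiv_right0 \<psi> = - \<infinity>"
    unfolding ederiv_right0_def by (rule tendsto_Lim[rotated]) simp
  with assms show False by simp
qed

text \<open>
  The mirror image of the argument at \<open>0\<close>: near a boundary point at \<open>1\<close> the slope tends to \<open>\<infinity>\<close>.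
\<close>

lemma one_in_domain:
  assumes "ederiv_left1 \<psi> < \<infinity>" shows "1 \<in> Int_dom"
proof (rule ccontr)
  assume not: "1 \<notin> Int_dom"
  define X :: "nat \<Rightarrow> real" where "X n = 1 - 1 / (real n + 2)" for n
  have X: "X n \<in> {1/2..<1}" for n by (auto simp: X_def field_simps)
  have XD: "X n \<in> Int_dom" for n
    using X[of n] open_unit_interval_subset by (auto simp: subset_iff)
  have "X \<longlonglongrightarrow> 1"
    unfolding X_def by real_asymp
  with not XD unit_interval_subset_domain
  have inf: "filterlim (\<lambda>n. \<bar>ederiv \<psi> (X n)\<bar>) at_top sequentially"
    by (intro mirror_deriv_blows_up) auto
  have "((\<lambda>x. ereal (ederiv \<psi> x)) \<longlongrightarrow> \<infinity>) (at_left 1)"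
    unfolding tendsto_PInfty
  proof
    fix B :: real
    have "eventually (\<lambda>n. \<bar>B\<bar> + \<bar>ederiv \<psi> (1/2)\<bar> < \<bar>ederiv \<psi> (X n)\<bar>) sequentially"
      using inf by (simp add: filterlim_at_top_dense)
    then obtain n where n: "\<bar>B\<bar> + \<bar>ederiv \<psi> (1/2)\<bar> < \<bar>ederiv \<psi> (X n)\<bar>"
      by (auto simp: eventually_sequentially)
    have "ederiv \<psi> (1/2) \<le> ederiv \<psi> (X n)"
      using X[of n] mirror_deriv_mono[OF _ XD, of "1/2" n] open_unit_interval_subset
      by (auto simp: subset_iff)
    with n have less: "B < ederiv \<psi> (X n)" by linarith
    have "B < ederiv \<psi> x" if "X n < x" "x < 1" for x
      using mirror_deriv_strict_mono[OF XD, of x n] that X[of n] open_unit_interval_subset less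
      by (fastforce simp: subset_iff)
    then show "\<forall>\<^sub>F x in at_left 1. ereal B < ereal (ederiv \<psi> x)"
      unfolding eventually_at_left_field using X[of n] by auto
  qed
  then have "ederiv_left1 \<psi> = \<infinity>"
    unfolding ederiv_left1_def by (rule tendsto_Lim[rotated]) simp
  with assms show False by simp
qed

lemma ederiv_right0_eq:
  assumes "0 \<in> Int_dom" shows "ederiv_right0 \<psi> = ereal (ederiv \<psi> 0)"
proof -
  have "(ederiv \<psi> \<longlongrightarrow> ederiv \<psi> 0) (at_right 0)"
    using mirror_deriv_continuous[OF assms] by (auto simp: isCont_def intro: filterlim_mono[OF _ order_refl at_le])
  then show ?thesis
    unfolding ederiv_right0_def by (intro tendsto_Lim) auto
qed

lemma ederiv_left1_eq:
  assumes "1 \<in> Int_dom" shows "ederiv_left1 \<psi> = ereal (ederiv \<psi> 1)"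
proof -
  have "(ederiv \<psi> \<longlongrightarrow> ederiv \<psi> 1) (at_left 1)"
    using mirror_deriv_continuous[OF assms] by (auto simp: isCont_def intro: filterlim_mono[OF _ order_refl at_le])
  then show ?thesis
    unfolding ederiv_left1_def by (intro tendsto_Lim) auto
qed

section \<open>Separable Bregman divergences and mirror descent steps\<close>

lemma separable_eq:
  fixes p :: "'a::finite \<Rightarrow> real"
  assumes "\<And>a. p a \<in> edom \<psi>"
  shows "separable \<psi> p = ereal (\<Sum>a\<in>UNIV. \<phi> (p a))"
  unfolding separable_def using mirror_finite[OF assms] by (simp flip: sum_ereal)

text \<open>
  Moving one coordinate within the interior of the domain changes only one summand, so near
  \<open>q a\<close> the extended-valued sum is \<open>\<phi>\<close> plus a real constant.
\<close>

lemma gradient_separable: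
  fixes q :: "'a::finite \<Rightarrow> real"
  assumes q: "\<And>a. q a \<in> Int_dom"
  shows "gradient (separable \<psi>) q a = ederiv \<psi> (q a)"
proof -
  have eq: "real_of_ereal (separable \<psi> (q(a := y))) = \<phi> y + (\<Sum>b\<in>-{a}. \<phi> (q b))" if "y \<in> Int_dom" for y
  proof -
    have "(q(a := y)) b \<in> edom \<psi>" for b
      using q that interior_subset[of "edom \<psi>"] by (auto simp: subset_iff)
    then have "real_of_ereal (separable \<psi> (q(a := y))) = (\<Sum>b\<in>UNIV. \<phi> ((q(a := y)) b))"
      by (subst separable_eq) simp_all
    also have "\<dots> = \<phi> y + (\<Sum>b\<in>-{a}. \<phi> ((q(a := y)) b))"
      by (subst sum.remove[of _ a]) (simp_all add: Compl_eq_Diff_UNIV)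
    also have "(\<Sum>b\<in>-{a}. \<phi> ((q(a := y)) b)) = (\<Sum>b\<in>-{a}. \<phi> (q b))"
      by (intro sum.cong) auto
    finally show ?thesis .
  qed
  have "eventually (\<lambda>y. y \<in> Int_dom) (nhds (q a))"
    using q by (intro eventually_nhds_in_open) auto
  then have "eventually (\<lambda>y. real_of_ereal (separable \<psi> (q(a := y)))
      = \<phi> y + (\<Sum>b\<in>-{a}. \<phi> (q b))) (nhds (q a))"
    by (rule eventually_mono) (rule eq)
  then have "gradient (separable \<psi>) q a = deriv (\<lambda>y. \<phi> y + (\<Sum>b\<in>-{a}. \<phi> (q b))) (q a)"
    unfolding gradient_def ederiv_def[of "\<lambda>x. separable \<psi> (q(a := x))"]
    by (rule deriv_cong_ev) simp
  also have "\<dots> = ederiv \<psi> (q a)"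
    by (rule DERIV_imp_deriv) (auto intro!: derivative_eq_intros mirror_has_derivative q)
  finally show ?thesis .
qed

definition sep_bregman :: "('a::finite \<Rightarrow> real) \<Rightarrow> ('a \<Rightarrow> real) \<Rightarrow> real" where
  "sep_bregman p q = (\<Sum>a\<in>UNIV. \<phi> (p a) - \<phi> (q a) - ederiv \<psi> (q a) * (p a - q a))"

lemma bregman_separable:
  fixes p q :: "'a::finite \<Rightarrow> real"
  assumes p: "\<And>a. p a \<in> edom \<psi>" and q: "\<And>a. q a \<in> Int_dom"
  shows "bregman (separable \<psi>) p q = ereal (sep_bregman p q)"
proof -
  have "\<And>a. q a \<in> edom \<psi>" using q interior_subset by blast
  then show ?thesis
    using p q
    by (simp add: bregman_def separable_eq gradient_separable sep_bregman_def sum_subtractf)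
qed

end

text \<open>
  Finite one-sided slopes put the whole unit interval into the interior of the domain, so that every
  distribution, on the boundary of the simplex or not, is a point of differentiability.
\<close>

locale finite_slope_mirror = mirror +
  assumes right0: "ederiv_right0 \<psi> > - \<infinity>"
    and left1: "ederiv_left1 \<psi> < \<infinity>"
begin

lemma unit_interval_subset_interior: "{0..1} \<subseteq> Int_dom"
proof -
  have "{0<..<1} \<union> {0, 1} \<subseteq> Int_dom"
    using open_unit_interval_subset zero_in_domain[OF right0] one_in_domain[OF left1] by auto
  moreover have "{0..1::real} \<subseteq> {0<..<1} \<union> {0, 1}" by auto
  ultimately show ?thesis by blast
qed

lemma slope_limits:
  "ederiv_right0 \<psi> = ereal (ederiv \<psi> 0)" "ederiv_left1 \<psi> = ereal (ederiv \<psi> 1)"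
  using zero_in_domain[OF right0] one_in_domain[OF left1]
  by (simp_all add: ederiv_right0_eq ederiv_left1_eq)

lemma pmf_in_domain: "pmf p a \<in> Int_dom" "pmf p a \<in> edom \<psi>"
proof -
  show "pmf p a \<in> Int_dom" using unit_interval_subset_interior pmf_le_1[of p a] by auto
  then show "pmf p a \<in> edom \<psi>" using interior_subset by blast
qed

lemma sep_bregman_three_point:
  fixes p q p' :: "'a::finite \<Rightarrow> real"
  shows "(\<Sum>a\<in>UNIV. (ederiv \<psi> (p a) - ederiv \<psi> (q a)) * (p' a - p a))
    = sep_bregman p' q - sep_bregman p' p - sep_bregman p q"
  unfolding sep_bregman_def sum_subtractf[symmetric]
  by (rule sum.cong) (simp_all add: algebra_simps)

lemma sep_bregman_nonneg:
  fixes p q :: "'a::finite pmf"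
  shows "sep_bregman (pmf p) (pmf q) \<ge> 0"
  unfolding sep_bregman_def
  using mirror_above_tangent[OF pmf_in_domain(1) pmf_in_domain(1)]
  by (intro sum_nonneg) (simp add: algebra_simps)

text \<open>
  The objective along the segment from the maximizer \<open>p\<close> to \<open>p'\<close> would increase near
  \<open>p\<close> if its directional derivative \<open>?l\<close> were positive. The segment consists of mixtures of \<open>p\<close> and
  \<open>p'\<close>, which are again distributions.
\<close>

lemma mirror_step_first_order:
  fixes p q p' :: "'a::finite pmf" and Q :: "'a \<Rightarrow> real"
  assumes max: "is_arg_max (\<lambda>p. ereal (\<eta> * (\<Sum>a\<in>UNIV. pmf p a * Q a))
      - bregman (separable \<psi>) (pmf p) (pmf q)) (\<lambda>_. True) p"
  shows "(\<Sum>a\<in>UNIV. (\<eta> * Q a - ederiv \<psi> (pmf p a) + ederiv \<psi> (pmf q a)) * (pmf p' a - pmf p a)) \<le> 0"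
    (is "?l \<le> 0")
proof (rule ccontr)
  assume "\<not> ?l \<le> 0"
  define x where "x t a = (1 - t) * pmf p a + t * pmf p' a" for t a
  define J where "J y = \<eta> * (\<Sum>a\<in>UNIV. y a * Q a) - sep_bregman y (pmf q)" for y
  have J_max: "J (pmf p'') \<le> J (pmf p)" for p''
  proof -
    have "\<not> (ereal (J (pmf p)) < ereal (J (pmf p'')))"
      using max by (simp add: is_arg_max_def J_def bregman_separable pmf_in_domain)
    then show ?thesis by simp
  qed
  have x0: "x 0 = pmf p" by (simp add: x_def fun_eq_iff)
  have "((\<lambda>t. J (x t)) has_real_derivative ?l) (at 0)"
  proof -
    let ?d = "\<lambda>a. pmf p' a - pmf p a"
    have dx: "((\<lambda>t. x t a) has_real_derivative ?d a) (at 0)" for a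
      unfolding x_def by (auto intro!: derivative_eq_intros)
    have df: "((\<lambda>t. \<phi> (x t a)) has_real_derivative ederiv \<psi> (pmf p a) * ?d a) (at 0)" for a
      by (rule DERIV_chain2[where f = \<phi>, OF _ dx]) (simp add: x0 mirror_has_derivative pmf_in_domain)
    have "((\<lambda>t. J (x t)) has_real_derivative \<eta> * (\<Sum>a\<in>UNIV. ?d a * Q a)
        - (\<Sum>a\<in>UNIV. ederiv \<psi> (pmf p a) * ?d a - 0 - ederiv \<psi> (pmf q a) * (?d a - 0))) (at 0)"
      unfolding J_def sep_bregman_def
      by (intro DERIV_diff DERIV_cmult DERIV_sum DERIV_cmult_right DERIV_const dx df)
    also have "\<eta> * (\<Sum>a\<in>UNIV. ?d a * Q a)
        - (\<Sum>a\<in>UNIV. ederiv \<psi> (pmf p a) * ?d a - 0 - ederiv \<psi> (pmf q a) * (?d a - 0)) = ?l"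
      unfolding sum_distrib_left sum_subtractf[symmetric]
      by (rule sum.cong) (simp_all add: algebra_simps)
    finally show ?thesis .
  qed
  from has_real_derivative_pos_inc_right[OF this] \<open>\<not> ?l \<le> 0\<close>
  obtain d where d: "d > 0" "\<And>h. 0 < h \<Longrightarrow> h < d \<Longrightarrow> J (x 0) < J (x h)" by auto
  \<comment> \<open>A parameter in the range of increase that is also a mixing weight.\<close>
  define t where "t = min (d / 2) 1"
  have t: "0 < t" "t < d" "t \<le> 1" using d(1) by (auto simp: t_def)
  have "x t = pmf (bind_pmf (bernoulli_pmf t) (\<lambda>b. if b then p' else p))"
    using t by (auto simp: x_def fun_eq_iff pmf_bind mult_ac)
  with d(2)[OF t(1,2)] J_max show False by (simp add: x0 leD)
qed

text \<open>
  Both suprema are finite, since \<open>\<phi>\<close> is continuous and \<open>\<psi>'\<close> monotone on \<open>[0,1]\<close>. In the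
  divergence, \<open>\<phi>\<close> contributes at most twice the first supremum, and the linear term at most twice the
  second, because two distributions have \<open>l\<^sub>1\<close>-distance at most \<open>2\<close>.
\<close>

lemma
  fixes p q :: "'a::finite pmf"
  shows C_const_finite: "C_const TYPE('a) \<psi> < \<infinity>"
    and sep_bregman_le_C_const: "sep_bregman (pmf p) (pmf q) \<le> real_of_ereal (C_const TYPE('a) \<psi>)"
proof -
  define H where "H p = (\<Sum>a\<in>UNIV. \<phi> (pmf p a))" for p :: "'a pmf"
  have sep: "\<bar>separable \<psi> (pmf p)\<bar> = ereal \<bar>H p\<bar>" for p :: "'a pmf"
    by (simp add: H_def separable_eq pmf_in_domain)
  have "continuous_on {0..1} \<phi>"
    using unit_interval_subset_interior by (intro continuous_at_imp_continuous_on ballI)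
      (blast intro: DERIV_isCont mirror_has_derivative)
  then have "bounded (\<phi> ` {0..1})"
    by (intro compact_imp_bounded compact_continuous_image) auto
  then obtain b where b: "\<And>x. x \<in> {0..1} \<Longrightarrow> \<bar>\<phi> x\<bar> \<le> b"
    unfolding bounded_iff by fastforce
  have H: "\<bar>H p\<bar> \<le> real CARD('a) * b" for p :: "'a pmf"
  proof -
    have "\<bar>H p\<bar> \<le> (\<Sum>a\<in>(UNIV::'a set). b)"
      unfolding H_def by (rule order_trans[OF sum_abs sum_mono]) (rule b, simp add: pmf_le_1)
    then show ?thesis by simp
  qed
  define b' where "b' = max \<bar>ederiv \<psi> 0\<bar> \<bar>ederiv \<psi> 1\<bar>"
  have b': "\<bar>ederiv \<psi> x\<bar> \<le> b'" if "x \<in> {0..1}" for x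
  proof -
    have "ederiv \<psi> 0 \<le> ederiv \<psi> x" "ederiv \<psi> x \<le> ederiv \<psi> 1"
      using that unit_interval_subset_interior by (auto intro!: mirror_deriv_mono)
    then show ?thesis by (auto simp: b'_def)
  qed
  obtain h where h: "(SUP p::'a pmf. \<bar>separable \<psi> (pmf p)\<bar>) = ereal h"
  proof -
    have "(SUP p::'a pmf. \<bar>separable \<psi> (pmf p)\<bar>) \<le> ereal (real CARD('a) * b)"
      unfolding sep by (rule SUP_least) (simp add: H)
    moreover have "ereal 0 \<le> (SUP p::'a pmf. \<bar>separable \<psi> (pmf p)\<bar>)"
      unfolding sep by (rule SUP_upper2) auto
    ultimately show ?thesis
      using that by (cases "SUP p::'a pmf. \<bar>separable \<psi> (pmf p)\<bar>") auto
  qed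
  obtain g where g: "(SUP x\<in>{0..1}. ereal \<bar>ederiv \<psi> x\<bar>) = ereal g"
  proof -
    have "(SUP x\<in>{0..1}. ereal \<bar>ederiv \<psi> x\<bar>) \<le> ereal b'"
      by (rule SUP_least) (simp add: b')
    moreover have "ereal 0 \<le> (SUP x\<in>{0..1}. ereal \<bar>ederiv \<psi> x\<bar>)"
      by (rule SUP_upper2[of 0]) auto
    ultimately show ?thesis
      using that by (cases "SUP x\<in>{0..1}. ereal \<bar>ederiv \<psi> x\<bar>") auto
  qed
  have C: "C_const TYPE('a) \<psi> = ereal (2 * h + 2 * g)"
    unfolding C_const_def h g by simp
  then show "C_const TYPE('a) \<psi> < \<infinity>" by simp
  have Hh: "\<bar>H p\<bar> \<le> h" for p :: "'a pmf"
    using SUP_upper[of p UNIV "\<lambda>p::'a pmf. \<bar>separable \<psi> (pmf p)\<bar>"] unfolding h unfolding sep by simp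
  have Dg: "\<bar>ederiv \<psi> (pmf q a)\<bar> \<le> g" for a
    using SUP_upper[of "pmf q a" "{0..1}" "\<lambda>x. ereal \<bar>ederiv \<psi> x\<bar>"] unfolding g
    by (simp add: pmf_le_1)
  have "g \<ge> 0" using Dg[of undefined] by linarith
  have "- (ederiv \<psi> (pmf q a) * (pmf p a - pmf q a)) \<le> g * (pmf p a + pmf q a)" for a
  proof -
    have "- (ederiv \<psi> (pmf q a) * (pmf p a - pmf q a)) \<le> \<bar>ederiv \<psi> (pmf q a)\<bar> * \<bar>pmf p a - pmf q a\<bar>"
      unfolding abs_mult[symmetric] by linarith
    also have "\<dots> \<le> g * (pmf p a + pmf q a)"
    proof (intro mult_mono Dg \<open>g \<ge> 0\<close>)
      show "\<bar>pmf p a - pmf q a\<bar> \<le> pmf p a + pmf q a"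
        using pmf_nonneg[of p a] pmf_nonneg[of q a] by linarith
    qed simp
    finally show ?thesis .
  qed
  then have "(\<Sum>a\<in>UNIV. - (ederiv \<psi> (pmf q a) * (pmf p a - pmf q a)))
      \<le> (\<Sum>a\<in>UNIV. g * (pmf p a + pmf q a))"
    by (intro sum_mono) auto
  also have "\<dots> = 2 * g"
    by (simp add: sum_distrib_left[symmetric] sum.distrib sum_pmf_eq_1)
  finally have "sep_bregman (pmf p) (pmf q) \<le> H p - H q + 2 * g"
    by (simp add: sep_bregman_def H_def sum_subtractf sum_negf)
  also have "\<dots> \<le> 2 * h + 2 * g"
    using Hh[of p] Hh[of q] by linarith
  finally show "sep_bregman (pmf p) (pmf q) \<le> real_of_ereal (C_const TYPE('a) \<psi>)"
    by (simp add: C)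
qed

end

section \<open>Policy mirror descent and its sublinear rate\<close>

text \<open>
  Moving all mass of \<open>a\<close> to \<open>b\<close> is a feasible direction at every distribution. It reduces the
  first-order condition over the simplex to a comparison of two coordinates.
\<close>

lemma sum_pmf_move:
  fixes p :: "'a::finite pmf" and G :: "'a \<Rightarrow> real"
  shows "(\<Sum>x\<in>UNIV. G x * (pmf (map_pmf (\<lambda>x. if x = a then b else x) p) x - pmf p x))
    = pmf p a * (G b - G a)"
proof -
  have "(\<Sum>x\<in>UNIV. G x * pmf (map_pmf (\<lambda>x. if x = a then b else x) p) x)
      = measure_pmf.expectation (map_pmf (\<lambda>x. if x = a then b else x) p) G"
    by (subst integral_measure_pmf[of UNIV]) (simp_all add: mult.commute)
  also have "\<dots> = (\<Sum>x\<in>UNIV. pmf p x * G (if x = a then b else x))"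
    by (subst integral_map_pmf) (simp add: integral_measure_pmf[of UNIV])
  finally have "(\<Sum>x\<in>UNIV. G x * (pmf (map_pmf (\<lambda>x. if x = a then b else x) p) x - pmf p x))
      = (\<Sum>x\<in>UNIV. pmf p x * (G (if x = a then b else x) - G x))"
    by (simp add: right_diff_distrib sum_subtractf mult.commute)
  also have "\<dots> = (\<Sum>x\<in>UNIV. if x = a then pmf p a * (G b - G a) else 0)"
    by (rule sum.cong) auto
  finally show ?thesis by simp
qed

locale pmd_run = discounted_mdp P r \<gamma> + finite_slope_mirror \<psi>
  for P :: "'s::finite \<Rightarrow> 'a::finite \<Rightarrow> 's pmf" and r \<gamma> \<psi> +
  fixes \<eta> :: real and \<pi> :: "nat \<Rightarrow> 's \<Rightarrow> 'a pmf"
  assumes step_size: "\<eta> > 0"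
    and pmd: "pmd P r \<gamma> \<psi> \<eta> \<pi>"
begin

lemma first_order:
  "(\<Sum>a\<in>UNIV. (\<eta> * Q_fun P r \<gamma> (\<pi> k) s a - ederiv \<psi> (pmf (\<pi> (Suc k) s) a)
      + ederiv \<psi> (pmf (\<pi> k s) a)) * (pmf p a - pmf (\<pi> (Suc k) s) a)) \<le> 0"
  by (rule mirror_step_first_order) (use pmd in \<open>unfold pmd_def, blast\<close>)

text \<open>
  The difference of slopes in the first-order condition is, by the three-point identity, a combination
  of divergences in which the distance to an arbitrary reference \<open>p\<close> occurs before and after the step.
\<close>

lemma three_point:
  "\<eta> * ((\<Sum>a\<in>UNIV. pmf p a * Q_fun P r \<gamma> (\<pi> k) s a)
      - (\<Sum>a\<in>UNIV. pmf (\<pi> (Suc k) s) a * Q_fun P r \<gamma> (\<pi> k) s a))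
    \<le> sep_bregman (pmf p) (pmf (\<pi> k s)) - sep_bregman (pmf p) (pmf (\<pi> (Suc k) s))
      - sep_bregman (pmf (\<pi> (Suc k) s)) (pmf (\<pi> k s))"
proof -
  let ?Q = "Q_fun P r \<gamma> (\<pi> k) s" and ?p' = "pmf (\<pi> (Suc k) s)" and ?q = "pmf (\<pi> k s)"
  have "(\<Sum>a\<in>UNIV. (\<eta> * ?Q a - ederiv \<psi> (?p' a) + ederiv \<psi> (?q a)) * (pmf p a - ?p' a))
      = \<eta> * ((\<Sum>a\<in>UNIV. pmf p a * ?Q a) - (\<Sum>a\<in>UNIV. ?p' a * ?Q a))
        - (\<Sum>a\<in>UNIV. (ederiv \<psi> (?p' a) - ederiv \<psi> (?q a)) * (pmf p a - ?p' a))"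
    unfolding sum_subtractf[symmetric] sum_distrib_left
    by (rule sum.cong) (simp_all add: algebra_simps)
  with first_order[of k s p] show ?thesis
    unfolding sep_bregman_three_point by linarith
qed

text \<open>
  Comparing the step with staying at \<open>\<pi>\<^sub>k\<close> gives the first inequality; it makes the old value a
  subsolution of the new Bellman equation, whence the second.
\<close>

lemma V_fun_improves:
  "V_fun P r \<gamma> (\<pi> k) s \<le> (\<Sum>a\<in>UNIV. pmf (\<pi> (Suc k) s) a * Q_fun P r \<gamma> (\<pi> k) s a)"
  "(\<Sum>a\<in>UNIV. pmf (\<pi> (Suc k) s) a * Q_fun P r \<gamma> (\<pi> k) s a) \<le> V_fun P r \<gamma> (\<pi> (Suc k)) s"
proof -
  let ?V = "V_fun P r \<gamma>"
  have greedy: "?V (\<pi> k) s \<le> (\<Sum>a\<in>UNIV. pmf (\<pi> (Suc k) s) a * Q_fun P r \<gamma> (\<pi> k) s a)" for s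
  proof -
    have "sep_bregman (pmf (\<pi> k s)) (pmf (\<pi> k s)) = 0"
      by (simp add: sep_bregman_def)
    then have "\<eta> * (?V (\<pi> k) s - (\<Sum>a\<in>UNIV. pmf (\<pi> (Suc k) s) a * Q_fun P r \<gamma> (\<pi> k) s a)) \<le> 0"
      using three_point[of "\<pi> k s" k s] sep_bregman_nonneg[of "\<pi> k s" "\<pi> (Suc k) s"]
        sep_bregman_nonneg[of "\<pi> (Suc k) s" "\<pi> k s"]
      unfolding V_fun_eq[of "\<pi> k"] by linarith
    then show ?thesis
      using step_size by (simp add: mult_le_0_iff)
  qed
  then show "?V (\<pi> k) s \<le> (\<Sum>a\<in>UNIV. pmf (\<pi> (Suc k) s) a * Q_fun P r \<gamma> (\<pi> k) s a)" .
  have le: "?V (\<pi> k) s \<le> ?V (\<pi> (Suc k)) s" for s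
    by (rule V_fun_ge) (use greedy in \<open>simp add: Q_fun_eq_backup\<close>)
  show "(\<Sum>a\<in>UNIV. pmf (\<pi> (Suc k) s) a * Q_fun P r \<gamma> (\<pi> k) s a) \<le> ?V (\<pi> (Suc k)) s"
    unfolding V_fun_eq[of "\<pi> (Suc k)" s] unfolding Q_fun_eq_backup
    using discount by (intro sum_mono mult_left_mono backup_mono le) auto
qed

lemma V_fun_mono: "k \<le> l \<Longrightarrow> V_fun P r \<gamma> (\<pi> k) s \<le> V_fun P r \<gamma> (\<pi> l) s"
  by (rule lift_Suc_mono_le[of "\<lambda>k. V_fun P r \<gamma> (\<pi> k) s"])
     (auto intro: order_trans[OF V_fun_improves])

definition rate_const :: real where
  "rate_const = real_of_ereal (C_const TYPE('a) \<psi>) / (\<eta> * (1 - \<gamma>)) + 1 / (1 - \<gamma>)\<^sup>2"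

lemma rate_const_pos: "rate_const > 0"
proof -
  have "0 \<le> real_of_ereal (C_const TYPE('a) \<psi>)"
    using sep_bregman_nonneg sep_bregman_le_C_const by (rule order_trans)
  then show ?thesis
    using step_size discount by (simp add: rate_const_def add_nonneg_pos)
qed

text \<open>
  Each step bounds the error by its average over successors under \<open>\<pi>\<^sup>*\<close>, the value gained in the
  step, and the drop of the divergence from \<open>\<pi>\<^sup>*\<close>. The last two telescope, and the comparison
  principle applies to the summed error \<open>U\<close>; since errors do not increase, the last one is at most the mean.
\<close>

lemma sublinear_convergence:
  "V_opt P r \<gamma> s - V_fun P r \<gamma> (\<pi> k) s \<le> rate_const / real (Suc k)"
proof -
  let ?V = "\<lambda>k. V_fun P r \<gamma> (\<pi> k)" and ?C = "real_of_ereal (C_const TYPE('a) \<psi>)"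
  obtain \<pi>s where opt: "V_fun P r \<gamma> \<pi>s = V_opt P r \<gamma>"
    using ex_optimal_policy by blast
  define u where "u k s = V_opt P r \<gamma> s - ?V k s" for k s
  define w where "w s = bind_pmf (\<pi>s s) (P s)" for s
  define B where "B k s = sep_bregman (pmf (\<pi>s s)) (pmf (\<pi> k s))" for k s
  define U where "U s = (\<Sum>i<Suc k. u i s)" for s
  \<comment> \<open>\<open>V\<^sup>*\<close> minus the \<open>\<pi>\<^sup>*\<close>-average of the current action values is the averaged error; the
    advantage of \<open>\<pi>\<^sup>*\<close> over the new policy is controlled by the three-point inequality.\<close>
  have step: "u i s \<le> \<gamma> * (\<Sum>s'\<in>UNIV. pmf (w s) s' * u i s')
      + (?V (Suc i) s - ?V i s) + (B i s - B (Suc i) s) / \<eta>" for i s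
  proof -
    let ?q = "\<lambda>p. \<Sum>a\<in>UNIV. pmf p a * Q_fun P r \<gamma> (\<pi> i) s a"
    have "V_opt P r \<gamma> s = (\<Sum>a\<in>UNIV. pmf (\<pi>s s) a * backup P r \<gamma> (V_opt P r \<gamma>) s a)"
      using V_fun_eq[of \<pi>s s] by (simp add: opt Q_fun_eq_backup)
    then have "V_opt P r \<gamma> s - ?q (\<pi>s s) = \<gamma> * (\<Sum>s'\<in>UNIV. pmf (w s) s' * u i s')"
      using sum_pmf_backup_diff[of "\<pi>s s" P r \<gamma> "V_opt P r \<gamma>" s "?V i"]
      by (simp add: Q_fun_eq_backup u_def w_def)
    moreover have "?q (\<pi>s s) - ?q (\<pi> (Suc i) s) \<le> (B i s - B (Suc i) s) / \<eta>"
    proof -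
      have "\<eta> * (?q (\<pi>s s) - ?q (\<pi> (Suc i) s)) \<le> B i s - B (Suc i) s"
        using three_point[of "\<pi>s s" i s] sep_bregman_nonneg[of "\<pi> (Suc i) s" "\<pi> i s"]
        unfolding B_def by linarith
      then show ?thesis using step_size by (simp add: pos_le_divide_eq mult.commute)
    qed
    ultimately show ?thesis
      using V_fun_improves(2)[of i s] by (simp add: u_def)
  qed
  have "U s \<le> (1 / (1 - \<gamma>) + ?C / \<eta>) / (1 - \<gamma>)"
  proof (rule discounted_comparison)
    fix s
    have "U s \<le> (\<Sum>i<Suc k. \<gamma> * (\<Sum>s'\<in>UNIV. pmf (w s) s' * u i s')
        + (?V (Suc i) s - ?V i s) + (B i s - B (Suc i) s) / \<eta>)"
      unfolding U_def by (intro sum_mono step)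
    also have "\<dots> = \<gamma> * (\<Sum>s'\<in>UNIV. pmf (w s) s' * U s')
        + (?V (Suc k) s - ?V 0 s) + (B 0 s - B (Suc k) s) / \<eta>"
    proof -
      have "(\<Sum>i<Suc k. \<gamma> * (\<Sum>s'\<in>UNIV. pmf (w s) s' * u i s'))
          = \<gamma> * (\<Sum>s'\<in>UNIV. pmf (w s) s' * U s')"
        unfolding U_def sum_distrib_left by (rule sum.swap)
      moreover have "(\<Sum>i<Suc k. (B i s - B (Suc i) s) / \<eta>) = (B 0 s - B (Suc k) s) / \<eta>"
        by (simp only: sum_divide_distrib[symmetric] sum_lessThan_telescope'[of "\<lambda>i. B i s" "Suc k"])
      ultimately show ?thesis
        by (simp only: sum.distrib sum_lessThan_telescope[of "\<lambda>i. ?V i s" "Suc k"])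
    qed
    also have "\<dots> \<le> \<gamma> * (\<Sum>s'\<in>UNIV. pmf (w s) s' * U s') + 1 / (1 - \<gamma>) + ?C / \<eta>"
    proof -
      have "B 0 s - B (Suc k) s \<le> ?C"
        using sep_bregman_le_C_const[of "\<pi>s s" "\<pi> 0 s"] sep_bregman_nonneg[of "\<pi>s s" "\<pi> (Suc k) s"]
        unfolding B_def by linarith
      then have "(B 0 s - B (Suc k) s) / \<eta> \<le> ?C / \<eta>"
        using step_size by (intro divide_right_mono) auto
      then show ?thesis
        using V_fun_bounds[of "\<pi> 0" s] V_fun_bounds[of "\<pi> (Suc k)" s] by linarith
    qed
    finally show "U s \<le> (1 / (1 - \<gamma>) + ?C / \<eta>) + \<gamma> * (\<Sum>s'\<in>UNIV. pmf (w s) s' * U s')"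
      by simp
  qed (use discount in auto)
  also have "\<dots> = rate_const"
    by (simp add: rate_const_def add_divide_distrib power2_eq_square)
  finally have "U s \<le> rate_const" .
  moreover have "real (Suc k) * u k s \<le> U s"
  proof -
    have "(\<Sum>i<Suc k. u k s) \<le> U s"
      unfolding U_def by (intro sum_mono) (auto simp: u_def V_fun_mono)
    then show ?thesis by simp
  qed
  ultimately show ?thesis
    by (simp add: u_def pos_le_divide_eq mult.commute)
qed

text \<open>
  The rate provides an index at which the error is at most \<open>\<sigma>\<close>, so the hitting time is attained;
  monotonicity of the values keeps the error at most \<open>\<sigma>\<close> from then on.
\<close>

lemma
  assumes \<sigma>: "\<sigma> > 0"
  shows hitting_time_bound: "int (hitting_time P r \<gamma> \<pi> \<sigma>) + 1 \<le> \<lceil>rate_const / \<sigma>\<rceil>"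
    and near_optimal_after_hitting_time:
      "hitting_time P r \<gamma> \<pi> \<sigma> \<le> k \<Longrightarrow> V_opt P r \<gamma> s - V_fun P r \<gamma> (\<pi> k) s \<le> \<sigma>"
proof -
  let ?near = "\<lambda>k. (MAX s. \<bar>V_opt P r \<gamma> s - V_fun P r \<gamma> (\<pi> k) s\<bar>) \<le> \<sigma>"
  have near: "?near k \<longleftrightarrow> (\<forall>s. V_opt P r \<gamma> s - V_fun P r \<gamma> (\<pi> k) s \<le> \<sigma>)" for k
    using V_fun_le_V_opt by (subst Max_le_iff) auto
  have n: "\<lceil>rate_const / \<sigma>\<rceil> \<ge> 1"
    using rate_const_pos \<sigma> by simp
  \<comment> \<open>The rate at index \<open>k\<close> has denominator \<open>k + 1\<close>, which accounts for the gain of one.\<close>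
  define K where "K = nat \<lceil>rate_const / \<sigma>\<rceil> - 1"
  have "rate_const / \<sigma> \<le> real (Suc K)"
    using n by (simp add: K_def nat_diff_distrib')
  then have "rate_const / real (Suc K) \<le> \<sigma>"
    using \<sigma> by (simp add: field_simps)
  with sublinear_convergence[of _ K] have K: "?near K"
    unfolding near using order_trans by blast
  have le: "hitting_time P r \<gamma> \<pi> \<sigma> \<le> K"
    unfolding hitting_time_def by (rule Least_le) (rule K)
  have hit: "?near (hitting_time P r \<gamma> \<pi> \<sigma>)"
    unfolding hitting_time_def by (rule LeastI) (rule K)
  show "int (hitting_time P r \<gamma> \<pi> \<sigma>) + 1 \<le> \<lceil>rate_const / \<sigma>\<rceil>"
    using le n unfolding K_def by linarith
  assume "hitting_time P r \<gamma> \<pi> \<sigma> \<le> k"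
  from V_fun_mono[OF this, of s] hit show "V_opt P r \<gamma> s - V_fun P r \<gamma> (\<pi> k) s \<le> \<sigma>"
    unfolding near by (meson diff_left_mono order_trans)
qed

section \<open>Finite termination\<close>

text \<open>
  The first-order condition tested with the transfer of the mass of \<open>a\<close> to \<open>b\<close>; positivity of
  that mass allows it to be cancelled.
\<close>

lemma exchange:
  assumes "pmf (\<pi> (Suc k) s) a > 0"
  shows "\<eta> * Q_fun P r \<gamma> (\<pi> k) s b - ederiv \<psi> (pmf (\<pi> (Suc k) s) b) + ederiv \<psi> (pmf (\<pi> k s) b)
    \<le> \<eta> * Q_fun P r \<gamma> (\<pi> k) s a - ederiv \<psi> (pmf (\<pi> (Suc k) s) a) + ederiv \<psi> (pmf (\<pi> k s) a)"
  using first_order[of k s "map_pmf (\<lambda>x. if x = a then b else x) (\<pi> (Suc k) s)"] assms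
  unfolding sum_pmf_move by (simp add: mult_le_0_iff)

lemma deriv_pmf_mono:
  "pmf p a \<le> pmf q b \<Longrightarrow> ederiv \<psi> (pmf p a) \<le> ederiv \<psi> (pmf q b)"
  by (intro mirror_deriv_mono pmf_in_domain)

lemma deriv_pmf_bounds: "ederiv \<psi> 0 \<le> ederiv \<psi> (pmf p a)" "ederiv \<psi> (pmf p a) \<le> ederiv \<psi> 1"
proof -
  have "0 \<in> Int_dom" "1 \<in> Int_dom"
    using unit_interval_subset_interior by auto
  from mirror_deriv_mono[OF this(1) pmf_in_domain(1) pmf_nonneg]
    mirror_deriv_mono[OF pmf_in_domain(1) this(2) pmf_le_1]
  show "ederiv \<psi> 0 \<le> ederiv \<psi> (pmf p a)" "ederiv \<psi> (pmf p a) \<le> ederiv \<psi> 1" .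
qed

text \<open>
  The action values are already optimal, so moving back from \<open>\<pi>\<^sub>k\<^sub>+\<^sub>1\<close> to \<open>\<pi>\<^sub>k\<close> does not decrease
  the linear part of the objective. The first-order condition then leaves a sum of nonnegative
  monotonicity terms that is at most zero.
\<close>

lemma optimal_policy_is_fixed:
  assumes opt: "\<pi> k \<in> optimal_policies P r \<gamma>"
  shows "\<pi> (Suc k) = \<pi> k"
proof (intro ext pmf_eqI)
  fix s a
  let ?p = "pmf (\<pi> (Suc k) s)" and ?q = "pmf (\<pi> k s)" and ?Q = "Q_fun P r \<gamma> (\<pi> k) s"
  have V: "V_fun P r \<gamma> (\<pi> k) = V_opt P r \<gamma>" using opt by (simp add: optimal_policies_def)
  have "(\<Sum>a\<in>UNIV. ?p a * ?Q a) \<le> V_fun P r \<gamma> (\<pi> (Suc k)) s"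
    by (rule V_fun_improves)
  also have "\<dots> \<le> V_fun P r \<gamma> (\<pi> k) s" unfolding V by (rule V_fun_le_V_opt)
  also have "\<dots> = (\<Sum>a\<in>UNIV. ?q a * ?Q a)" by (rule V_fun_eq)
  finally have "0 \<le> \<eta> * (\<Sum>a\<in>UNIV. ?q a * ?Q a - ?p a * ?Q a)"
    using step_size by (simp add: sum_subtractf)
  moreover have "(\<Sum>a\<in>UNIV. (\<eta> * ?Q a - ederiv \<psi> (?p a) + ederiv \<psi> (?q a)) * (?q a - ?p a))
      = \<eta> * (\<Sum>a\<in>UNIV. ?q a * ?Q a - ?p a * ?Q a)
        + (\<Sum>a\<in>UNIV. (ederiv \<psi> (?q a) - ederiv \<psi> (?p a)) * (?q a - ?p a))"
    unfolding sum_distrib_left sum.distrib[symmetric]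
    by (rule sum.cong) (simp_all add: algebra_simps)
  ultimately have "(\<Sum>a\<in>UNIV. (ederiv \<psi> (?q a) - ederiv \<psi> (?p a)) * (?q a - ?p a)) \<le> 0"
    using first_order[of k s "\<pi> k s"] by linarith
  moreover have nonneg: "0 \<le> (ederiv \<psi> (?q a) - ederiv \<psi> (?p a)) * (?q a - ?p a)" for a
  proof (cases "?p a \<le> ?q a")
    case True
    then show ?thesis
      using deriv_pmf_mono[of "\<pi> (Suc k) s" a "\<pi> k s" a] by simp
  next
    case False
    then show ?thesis
      using deriv_pmf_mono[of "\<pi> k s" a "\<pi> (Suc k) s" a] by (simp add: mult_nonpos_nonpos)
  qed
  ultimately have "(\<Sum>a\<in>UNIV. (ederiv \<psi> (?q a) - ederiv \<psi> (?p a)) * (?q a - ?p a)) = 0"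
    by (intro antisym sum_nonneg)
  then have "(ederiv \<psi> (?q a) - ederiv \<psi> (?p a)) * (?q a - ?p a) = 0"
    using nonneg by (subst (asm) sum_nonneg_eq_0_iff) auto
  then show "?p a = ?q a"
    using mirror_deriv_strict_mono[OF pmf_in_domain(1) pmf_in_domain(1), of "\<pi> k s" a "\<pi> (Suc k) s" a]
      mirror_deriv_strict_mono[OF pmf_in_domain(1) pmf_in_domain(1), of "\<pi> (Suc k) s" a "\<pi> k s" a]
    by (cases "?p a" "?q a" rule: linorder_cases) auto
qed

definition "suboptimal s = - optimal_actions P r \<gamma> s"

context
  fixes T :: nat
  assumes near_optimal: "\<And>k s. T \<le> k \<Longrightarrow> V_opt P r \<gamma> s - V_fun P r \<gamma> (\<pi> k) s \<le> gap P r \<gamma> / 4"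
begin

text \<open>
  Optimal actions lose at most a quarter of the gap by replacing \<open>Q\<^sup>*\<close> with the current action
  values, and suboptimal ones gain nothing.
\<close>

lemma Q_fun_separation:
  assumes "T \<le> k" "b \<in> optimal_actions P r \<gamma> s" "a \<in> suboptimal s"
  shows "Q_fun P r \<gamma> (\<pi> k) s a + 3 / 4 * gap P r \<gamma> \<le> Q_fun P r \<gamma> (\<pi> k) s b"
proof -
  have "Q_fun P r \<gamma> (\<pi> k) s a \<le> Q_opt P r \<gamma> s a" by (rule Q_fun_le_Q_opt)
  also have "\<dots> \<le> V_opt P r \<gamma> s - gap P r \<gamma>"
    using assms by (intro Q_opt_le_minus_gap) (simp add: suboptimal_def)
  also have "V_opt P r \<gamma> s = Q_opt P r \<gamma> s b"
    using assms by (simp add: optimal_actions_def)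
  also have "Q_opt P r \<gamma> s b \<le> Q_fun P r \<gamma> (\<pi> k) s b + gap P r \<gamma> / 4"
    using Q_fun_near_Q_opt[OF near_optimal[OF assms(1)], of s b] by linarith
  finally show ?thesis by simp
qed

lemma exchange_suboptimal:
  assumes "T \<le> k" "b \<in> optimal_actions P r \<gamma> s" "a \<in> suboptimal s" "pmf (\<pi> (Suc k) s) a > 0"
  shows "ederiv \<psi> (pmf (\<pi> (Suc k) s) a) - ederiv \<psi> (pmf (\<pi> (Suc k) s) b) + \<eta> * (3 / 4 * gap P r \<gamma>)
    \<le> ederiv \<psi> (pmf (\<pi> k s) a) - ederiv \<psi> (pmf (\<pi> k s) b)"
proof -
  have "\<eta> * (Q_fun P r \<gamma> (\<pi> k) s a + 3 / 4 * gap P r \<gamma>) \<le> \<eta> * Q_fun P r \<gamma> (\<pi> k) s b"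
    using Q_fun_separation[OF assms(1-3)] step_size by simp
  with exchange[OF assms(4), of b] show ?thesis by (simp add: distrib_left)
qed

text \<open>
  A suboptimal action that gained mass would raise \<open>\<psi>'\<close> at itself and hence, by the exchange
  inequality, also at every optimal action. The optimal actions carried all the mass before, so the
  total would exceed one.
\<close>

lemma suboptimal_mass_stays_zero:
  assumes gap: "gap P r \<gamma> > 0" and k: "T \<le> k"
    and zero: "\<And>a. a \<in> suboptimal s \<Longrightarrow> pmf (\<pi> k s) a = 0"
    and a: "a \<in> suboptimal s"
  shows "pmf (\<pi> (Suc k) s) a = 0"
proof (rule ccontr)
  let ?p = "pmf (\<pi> (Suc k) s)" and ?q = "pmf (\<pi> k s)" and ?O = "optimal_actions P r \<gamma> s"
  assume "?p a \<noteq> 0"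
  then have pos: "?p a > 0" by (simp add: less_le)
  have grows: "?q b \<le> ?p b" if "b \<in> ?O" for b
  proof (rule ccontr)
    assume "\<not> ?q b \<le> ?p b"
    then have "ederiv \<psi> (?p b) \<le> ederiv \<psi> (?q b)" by (intro deriv_pmf_mono) simp
    moreover have "ederiv \<psi> (?q a) \<le> ederiv \<psi> (?p a)"
      using zero[OF a] by (intro deriv_pmf_mono) simp
    moreover have "0 < \<eta> * (3 / 4 * gap P r \<gamma>)" using gap step_size by simp
    ultimately show False using exchange_suboptimal[OF k that a pos] by linarith
  qed
  have "1 = (\<Sum>b\<in>UNIV. ?q b)" by (simp add: sum_pmf_eq_1)
  also have "\<dots> = (\<Sum>b\<in>?O. ?q b)"
    using zero by (intro sum.mono_neutral_right) (auto simp: suboptimal_def)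
  also have "\<dots> \<le> (\<Sum>b\<in>?O. ?p b)" by (intro sum_mono grows)
  also have "\<dots> < (\<Sum>b\<in>insert a ?O. ?p b)"
    using a pos by (simp add: suboptimal_def)
  also have "\<dots> \<le> (\<Sum>b\<in>UNIV. ?p b)" by (intro sum_mono2) auto
  also have "\<dots> = 1" by (simp add: sum_pmf_eq_1)
  finally show False by simp
qed

text \<open>
  The potential is \<open>\<psi>'(m) - \<psi>'(\<pi>(b))\<close>, where \<open>m\<close> is the largest suboptimal mass and \<open>b\<close> a fixed
  optimal action. An action attaining the new maximum has positive mass, so the exchange inequality
  applies to it, and its old mass is at most the old maximum.
\<close>

lemma suboptimal_mass_vanishes:
  assumes gap: "gap P r \<gamma> > 0"
    and n: "2 * (ederiv \<psi> 1 - ederiv \<psi> 0) < real n * (\<eta> * (3 / 4 * gap P r \<gamma>))"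
    and a: "a \<in> suboptimal s"
  shows "pmf (\<pi> (T + n) s) a = 0"
proof (rule ccontr)
  define \<delta> where "\<delta> = \<eta> * (3 / 4 * gap P r \<gamma>)"
  assume pos: "pmf (\<pi> (T + n) s) a \<noteq> 0"
  define m where "m i = Max (pmf (\<pi> (T + i) s) ` suboptimal s)" for i
  obtain b where b: "b \<in> optimal_actions P r \<gamma> s" using ex_optimal_action by blast
  have m_in: "m i \<in> pmf (\<pi> (T + i) s) ` suboptimal s" for i
    unfolding m_def using a by (intro Max_in) auto
  have le_m: "pmf (\<pi> (T + i) s) c \<le> m i" if "c \<in> suboptimal s" for i c
    unfolding m_def using that by (intro Max_ge) auto
  have m_pos: "m i > 0" if "i \<le> n" for i
  proof (rule ccontr)
    assume "\<not> m i > 0"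
    \<comment> \<open>Suboptimal mass that is zero at time \<open>T + i\<close> would still be zero at time \<open>T + n\<close>.\<close>
    then have "pmf (\<pi> (T + i) s) c = 0" if "c \<in> suboptimal s" for c
      using le_m[OF that, of i] pmf_nonneg[of "\<pi> (T + i) s" c] by linarith
    with that have "\<forall>c\<in>suboptimal s. pmf (\<pi> (T + n) s) c = 0"
    proof (induction n rule: dec_induct)
      case (step l)
      then show ?case
        using suboptimal_mass_stays_zero[OF gap, of "T + l" s] by simp
    qed simp
    with a pos show False by blast
  qed
  have "ederiv \<psi> (m i) - ederiv \<psi> (pmf (\<pi> (T + i) s) b) + real i * \<delta>
      \<le> ederiv \<psi> 1 - ederiv \<psi> 0" if "i \<le> n" for i
    using that
  proof (induction i)
    case 0
    obtain c where "m 0 = pmf (\<pi> (T + 0) s) c" using m_in by blast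
    then show ?case
      using deriv_pmf_bounds[of "\<pi> T s"] by (simp add: diff_mono)
  next
    case (Suc i)
    obtain c where c: "c \<in> suboptimal s" "m (Suc i) = pmf (\<pi> (Suc (T + i)) s) c"
      using m_in[of "Suc i"] by auto
    obtain c' where c': "m i = pmf (\<pi> (T + i) s) c'" using m_in by blast
    have "ederiv \<psi> (pmf (\<pi> (T + i) s) c) \<le> ederiv \<psi> (m i)"
      unfolding c' using le_m[OF c(1), of i] by (intro deriv_pmf_mono) (simp add: c')
    moreover have "pmf (\<pi> (Suc (T + i)) s) c > 0"
      using m_pos[OF Suc.prems] c(2) by simp
    note exchange_suboptimal[OF _ b c(1) this]
    moreover have "ederiv \<psi> (m i) - ederiv \<psi> (pmf (\<pi> (T + i) s) b) + real i * \<delta>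
        \<le> ederiv \<psi> 1 - ederiv \<psi> 0"
      using Suc by simp
    ultimately show ?case
      unfolding c(2) \<delta>_def[symmetric] of_nat_Suc distrib_right add_Suc_right by simp
  qed
  note bound = this[of n, OF order_refl]
  obtain c where "m n = pmf (\<pi> (T + n) s) c" using m_in[of n] by blast
  with bound have "ederiv \<psi> (pmf (\<pi> (T + n) s) c) - ederiv \<psi> (pmf (\<pi> (T + n) s) b)
      + real n * \<delta> \<le> ederiv \<psi> 1 - ederiv \<psi> 0"
    by simp
  then have "real n * \<delta> \<le> (ederiv \<psi> 1 - ederiv \<psi> 0)
      + (ederiv \<psi> (pmf (\<pi> (T + n) s) b) - ederiv \<psi> (pmf (\<pi> (T + n) s) c))"
    by (simp add: algebra_simps)
  also have "\<dots> \<le> (ederiv \<psi> 1 - ederiv \<psi> 0) + (ederiv \<psi> 1 - ederiv \<psi> 0)"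
    by (intro add_left_mono diff_mono deriv_pmf_bounds)
  finally show False
    using n[folded \<delta>_def] by simp
qed

lemma optimal_from:
  assumes "gap P r \<gamma> > 0"
    and "2 * (ederiv \<psi> 1 - ederiv \<psi> 0) < real n * (\<eta> * (3 / 4 * gap P r \<gamma>))"
    and "t \<ge> T + n"
  shows "\<pi> t = \<pi> (T + n) \<and> \<pi> (T + n) \<in> optimal_policies P r \<gamma>"
proof -
  have opt: "\<pi> (T + n) \<in> optimal_policies P r \<gamma>"
    unfolding optimal_policies_iff
    using suboptimal_mass_vanishes[OF assms(1,2)] by (force simp: suboptimal_def)
  have "\<pi> t = \<pi> (T + n)"
    using assms(3) by (induction t rule: dec_induct) (simp_all add: optimal_policy_is_fixed opt)
  with opt show ?thesis by simp
qed

end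
end

theorem theorem3p4:
  fixes P :: "'s::finite \<Rightarrow> 'a::finite \<Rightarrow> 's pmf"
    and r :: "'s \<Rightarrow> 'a \<Rightarrow> real"
    and \<gamma> \<eta> :: real
    and \<psi> :: "real \<Rightarrow> ereal"
    and \<pi> :: "nat \<Rightarrow> 's \<Rightarrow> 'a pmf"
  assumes reward: "\<And>s a. r s a \<in> {0..1}"
    and discount: "\<gamma> \<in> {0..<1}"
    and nontrivial: "nontrivial_states P r \<gamma> \<noteq> {}"
    and mirror: "mirror_map \<psi>"
    and step_size: "\<eta> > 0"
    and pmd: "pmd P r \<gamma> \<psi> \<eta> \<pi>"
    and right0: "ederiv_right0 \<psi> > -\<infinity>"
    and left1: "ederiv_left1 \<psi> < \<infinity>"
  shows "C_const TYPE('a) \<psi> < \<infinity> \<and>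
    (\<exists>T_ter.
      (\<forall>t\<ge>T_ter. \<pi> t = \<pi> T_ter \<and> \<pi> T_ter \<in> optimal_policies P r \<gamma>) \<and>
      int T_ter
        \<le> int (hitting_time P r \<gamma> \<pi> (gap P r \<gamma> / 4))
          + \<lceil>4 * (real_of_ereal (ederiv_left1 \<psi>) - real_of_ereal (ederiv_right0 \<psi>))
              / (\<eta> * gap P r \<gamma>)\<rceil> + 1 \<and>
      int (hitting_time P r \<gamma> \<pi> (gap P r \<gamma> / 4))
          + \<lceil>4 * (real_of_ereal (ederiv_left1 \<psi>) - real_of_ereal (ederiv_right0 \<psi>))
              / (\<eta> * gap P r \<gamma>)\<rceil> + 1
        \<le> \<lceil>4 / gap P r \<gamma> *
              (real_of_ereal (C_const TYPE('a) \<psi>) / (\<eta> * (1 - \<gamma>)) + 1 / (1 - \<gamma>)\<^sup>2)\<rceil>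
          + \<lceil>4 * (real_of_ereal (ederiv_left1 \<psi>) - real_of_ereal (ederiv_right0 \<psi>))
              / (\<eta> * gap P r \<gamma>)\<rceil>)"
proof -
  interpret pmd_run P r \<gamma> \<psi> \<eta> \<pi>
    by unfold_locales (rule reward discount mirror right0 left1 step_size pmd)+
  let ?T = "hitting_time P r \<gamma> \<pi> (gap P r \<gamma> / 4)"
  define M where "M = ederiv \<psi> 1 - ederiv \<psi> 0"
  \<comment> \<open>The extra step makes \<open>N\<close> strictly larger than \<open>4M/(\<eta>\<Delta>)\<close>, which is at least the
    \<open>8M/(3\<eta>\<Delta>)\<close> that the potential argument allows.\<close>
  define N where "N = nat \<lceil>4 * M / (\<eta> * gap P r \<gamma>)\<rceil> + 1"
  have gap: "gap P r \<gamma> > 0" by (rule gap_pos[OF nontrivial])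
  have "M \<ge> 0"
    unfolding M_def using deriv_pmf_bounds[of "\<pi> 0 undefined" undefined] by linarith
  then have "0 \<le> 4 * M / (\<eta> * gap P r \<gamma>)"
    using step_size gap by simp
  then have "0 \<le> \<lceil>4 * M / (\<eta> * gap P r \<gamma>)\<rceil>"
    by linarith
  then have N: "int N = \<lceil>4 * M / (\<eta> * gap P r \<gamma>)\<rceil> + 1"
    by (simp add: N_def)
  have "4 * M / (\<eta> * gap P r \<gamma>) < real N"
    using N by linarith
  then have "4 * M < real N * (\<eta> * gap P r \<gamma>)"
    using step_size gap by (simp add: pos_divide_less_eq)
  then have long: "2 * M < real N * (\<eta> * (3 / 4 * gap P r \<gamma>))"
    using \<open>M \<ge> 0\<close> by simp
  have near: "V_opt P r \<gamma> s - V_fun P r \<gamma> (\<pi> k) s \<le> gap P r \<gamma> / 4" if "?T \<le> k" for k s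
    using gap that by (intro near_optimal_after_hitting_time) simp_all
  have slopes: "real_of_ereal (ederiv_left1 \<psi>) - real_of_ereal (ederiv_right0 \<psi>) = M"
    by (simp add: slope_limits M_def)
  have "int ?T + 1 \<le> \<lceil>4 / gap P r \<gamma> * rate_const\<rceil>"
    using hitting_time_bound[of "gap P r \<gamma> / 4"] gap by (simp add: mult.commute)
  then have rate: "int ?T + 1 \<le> \<lceil>4 / gap P r \<gamma> *
      (real_of_ereal (C_const TYPE('a) \<psi>) / (\<eta> * (1 - \<gamma>)) + 1 / (1 - \<gamma>)\<^sup>2)\<rceil>"
    unfolding rate_const_def .
  show ?thesis
    unfolding slopes
  proof (intro conjI exI allI impI)
    show "C_const TYPE('a) \<psi> < \<infinity>" by (rule C_const_finite)
    show "\<pi> t = \<pi> (?T + N)" "\<pi> (?T + N) \<in> optimal_policies P r \<gamma>" if "t \<ge> ?T + N" for t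
      using optimal_from[OF near gap long[unfolded M_def] that] by blast+
    show "int (?T + N) \<le> int ?T + \<lceil>4 * M / (\<eta> * gap P r \<gamma>)\<rceil> + 1"
      by (simp only: of_nat_add N add.assoc order_refl)
    show "int ?T + \<lceil>4 * M / (\<eta> * gap P r \<gamma>)\<rceil> + 1 \<le> \<lceil>4 / gap P r \<gamma> *
        (real_of_ereal (C_const TYPE('a) \<psi>) / (\<eta> * (1 - \<gamma>)) + 1 / (1 - \<gamma>)\<^sup>2)\<rceil>
        + \<lceil>4 * M / (\<eta> * gap P r \<gamma>)\<rceil>"
      using rate by linarith
  qed
qed

end
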